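(* Let $S$ be a scheme and let $\mathcal{P}$ be a property of points of $S$. Suppose that there exist a countable scheme $S'$, a morphism $\pi\colon S\to S'$ and a property $\mathcal{P}'$ of points of $S'$ such that $\mathcal{P}$ descends to $\mathcal{P}'$ along $\pi$. Assume further that $\mathcal{P}'$ satisfies the specialization condition. Then there exists a countable collection $\{S_j\}_{j\geqslant 1}$ of closed subschemes of $S$ such that a point $s\in S$ has property $\mathcal{P}$ if and only if $s$ lies in $S_j$ for some $j\geqslant 1$.
   Context: A property $\mathcal{P}$ of points of a scheme $S$ is a predicate on the points of the underlying topological space of $S$: for each $s\in S$ it is either true or false. A scheme is countable if its underlying set of points is countable. A property $\mathcal{P}$ of points of $S$ satisfies the specialization condition if, whenever $s\in S$ has property $\mathcal{P}$ and $s_0\in S$ lies in the Zariski closure of $\{s\}$, the point $s_0$ also has property $\mathcal{P}$. Given a morphism $\pi\colon S\to S'$ and a property $\mathcal{P}'$ of points of $S'$, one says that $\mathcal{P}$ descends to $\mathcal{P}'$ along $\pi$ if for all $s\in S$, the point $s$ satisfies $\mathcal{P}$ if and only if $\pi(s)$ satisfies $\mathcal{P}'$. *)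

theory Defs
  imports
    "HOL-Algebra.QuotRing"
    "HOL-Analysis.Abstract_Topology"
    "HOL-Library.Countable_Set"
begin

section \<open>Ringed spaces, stalks\<close>

record ('p, 'a) rspace =
  topo :: "'p topology"
  sect :: "'p set \<Rightarrow> 'a ring"
  res :: "'p set \<Rightarrow> 'p set \<Rightarrow> 'a \<Rightarrow> 'a"

abbreviation points :: "('p, 'a) rspace \<Rightarrow> 'p set" where
  "points X \<equiv> topspace (topo X)"

abbreviation is_open :: "('p, 'a) rspace \<Rightarrow> 'p set \<Rightarrow> bool" where
  "is_open X \<equiv> openin (topo X)"

text \<open>
  The values of \<open>sect\<close> and \<open>res\<close> matter only on open sets and on carriers. The zero ring is
  a commutative ring here, and \<open>separated\<close> for the empty cover makes the sections over the
  empty set a zero ring.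
\<close>

locale ringed_space =
  fixes X :: "('p, 'a) rspace"
  assumes sect_cring: "is_open X U \<Longrightarrow> cring (sect X U)"
    and res_hom: "\<lbrakk>is_open X U; is_open X V; V \<subseteq> U\<rbrakk>
      \<Longrightarrow> res X U V \<in> ring_hom (sect X U) (sect X V)"
    and res_id: "\<lbrakk>is_open X U; f \<in> carrier (sect X U)\<rbrakk> \<Longrightarrow> res X U U f = f"
    and res_res: "\<lbrakk>is_open X U; is_open X V; is_open X W; W \<subseteq> V; V \<subseteq> U; f \<in> carrier (sect X U)\<rbrakk>
      \<Longrightarrow> res X V W (res X U V f) = res X U W f"
    and separated: "\<lbrakk>\<And>V. V \<in> \<U> \<Longrightarrow> is_open X V;
        f \<in> carrier (sect X (\<Union>\<U>)); g \<in> carrier (sect X (\<Union>\<U>));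
        \<And>V. V \<in> \<U> \<Longrightarrow> res X (\<Union>\<U>) V f = res X (\<Union>\<U>) V g\<rbrakk> \<Longrightarrow> f = g"
    and gluing: "\<lbrakk>\<And>V. V \<in> \<U> \<Longrightarrow> is_open X V;
        \<And>V. V \<in> \<U> \<Longrightarrow> h V \<in> carrier (sect X V);
        \<And>V W. \<lbrakk>V \<in> \<U>; W \<in> \<U>\<rbrakk> \<Longrightarrow> res X V (V \<inter> W) (h V) = res X W (V \<inter> W) (h W)\<rbrakk>
      \<Longrightarrow> \<exists>f \<in> carrier (sect X (\<Union>\<U>)). \<forall>V \<in> \<U>. res X (\<Union>\<U>) V f = h V"

definition germ :: "('p, 'a) rspace \<Rightarrow> 'p \<Rightarrow> 'p set \<Rightarrow> 'a \<Rightarrow> ('p set \<times> 'a) set" where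
  "germ X x U f = {(V, g). is_open X V \<and> x \<in> V \<and> g \<in> carrier (sect X V) \<and>
     (\<exists>W. is_open X W \<and> x \<in> W \<and> W \<subseteq> U \<inter> V \<and> res X U W f = res X V W g)}"

text \<open>
  Operations on germs are computed on representatives; the result does not depend on them, so
  the unions below are unions of copies of one and the same germ.
\<close>

definition stalk :: "('p, 'a) rspace \<Rightarrow> 'p \<Rightarrow> ('p set \<times> 'a) set ring" where
  "stalk X x = \<lparr>
     carrier = {germ X x U f | U f. is_open X U \<and> x \<in> U \<and> f \<in> carrier (sect X U)},
     mult = (\<lambda>a b. \<Union>(U, f) \<in> a. \<Union>(V, g) \<in> b.
       germ X x (U \<inter> V) (res X U (U \<inter> V) f \<otimes>\<^bsub>sect X (U \<inter> V)\<^esub> res X V (U \<inter> V) g)),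
     one = germ X x (points X) \<one>\<^bsub>sect X (points X)\<^esub>,
     zero = germ X x (points X) \<zero>\<^bsub>sect X (points X)\<^esub>,
     add = (\<lambda>a b. \<Union>(U, f) \<in> a. \<Union>(V, g) \<in> b.
       germ X x (U \<inter> V) (res X U (U \<inter> V) f \<oplus>\<^bsub>sect X (U \<inter> V)\<^esub> res X V (U \<inter> V) g))\<rparr>"

section \<open>Locally ringed spaces and their morphisms\<close>

definition local_ring :: "('a, 'm) ring_scheme \<Rightarrow> bool" where
  "local_ring R \<longleftrightarrow> cring R \<and> (\<exists>!m. maximalideal m R)"

definition max_ideal :: "('a, 'm) ring_scheme \<Rightarrow> 'a set" where
  "max_ideal R = (THE m. maximalideal m R)"

definition local_hom :: "('a, 'm) ring_scheme \<Rightarrow> ('b, 'n) ring_scheme \<Rightarrow> ('a \<Rightarrow> 'b) \<Rightarrow> bool" where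
  "local_hom R T h \<longleftrightarrow>
     h \<in> ring_hom R T \<and> {r \<in> carrier R. h r \<in> max_ideal T} = max_ideal R"

locale locally_ringed_space = ringed_space +
  assumes stalk_local: "x \<in> points X \<Longrightarrow> local_ring (stalk X x)"

text \<open>
  A morphism \<open>X \<rightarrow> Y\<close> is a map of points together with, for each open \<open>V\<close> of \<open>Y\<close>, a ring
  homomorphism from the sections over \<open>V\<close> to the sections over the preimage of \<open>V\<close>.
\<close>

record ('p, 'a, 'q, 'b) rmorph =
  base :: "'p \<Rightarrow> 'q"
  comorph :: "'q set \<Rightarrow> 'b \<Rightarrow> 'a"

definition preim :: "('p, 'a) rspace \<Rightarrow> ('p, 'a, 'q, 'b) rmorph \<Rightarrow> 'q set \<Rightarrow> 'p set" where
  "preim X \<phi> V = {x \<in> points X. base \<phi> x \<in> V}"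

definition stalk_map ::
  "('p, 'a) rspace \<Rightarrow> ('p, 'a, 'q, 'b) rmorph \<Rightarrow> 'p \<Rightarrow> ('q set \<times> 'b) set \<Rightarrow> ('p set \<times> 'a) set" where
  "stalk_map X \<phi> x a = (\<Union>(V, g) \<in> a. germ X x (preim X \<phi> V) (comorph \<phi> V g))"

definition lrs_morphism ::
  "('p, 'a) rspace \<Rightarrow> ('q, 'b) rspace \<Rightarrow> ('p, 'a, 'q, 'b) rmorph \<Rightarrow> bool" where
  "lrs_morphism X Y \<phi> \<longleftrightarrow>
     locally_ringed_space X \<and> locally_ringed_space Y \<and>
     continuous_map (topo X) (topo Y) (base \<phi>) \<and>
     (\<forall>V. is_open Y V \<longrightarrow> comorph \<phi> V \<in> ring_hom (sect Y V) (sect X (preim X \<phi> V))) \<and>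
     (\<forall>V W. is_open Y V \<and> is_open Y W \<and> W \<subseteq> V \<longrightarrow>
        (\<forall>g \<in> carrier (sect Y V).
           res X (preim X \<phi> V) (preim X \<phi> W) (comorph \<phi> V g) = comorph \<phi> W (res Y V W g))) \<and>
     (\<forall>x \<in> points X. local_hom (stalk Y (base \<phi> x)) (stalk X x) (stalk_map X \<phi> x))"

definition lrs_isomorphism ::
  "('p, 'a) rspace \<Rightarrow> ('q, 'b) rspace \<Rightarrow> ('p, 'a, 'q, 'b) rmorph \<Rightarrow> bool" where
  "lrs_isomorphism X Y \<phi> \<longleftrightarrow>
     lrs_morphism X Y \<phi> \<and> homeomorphic_map (topo X) (topo Y) (base \<phi>) \<and>
     (\<forall>V. is_open Y V \<longrightarrow> comorph \<phi> V \<in> ring_iso (sect Y V) (sect X (preim X \<phi> V)))"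

definition open_subspace :: "('p, 'a) rspace \<Rightarrow> 'p set \<Rightarrow> ('p, 'a) rspace" where
  "open_subspace X U = \<lparr>topo = subtopology (topo X) U, sect = sect X, res = res X\<rparr>"

section \<open>Rings of functions with values in a family of rings\<close>

definition fun_ring ::
  "'p set \<Rightarrow> ('p \<Rightarrow> ('a, 'm) ring_scheme) \<Rightarrow> ('p \<Rightarrow> 'a) set \<Rightarrow> ('p \<Rightarrow> 'a) ring" where
  "fun_ring U F C = \<lparr>
     carrier = C,
     mult = (\<lambda>s t. \<lambda>x\<in>U. s x \<otimes>\<^bsub>F x\<^esub> t x),
     one = (\<lambda>x\<in>U. \<one>\<^bsub>F x\<^esub>),
     zero = (\<lambda>x\<in>U. \<zero>\<^bsub>F x\<^esub>),
     add = (\<lambda>s t. \<lambda>x\<in>U. s x \<oplus>\<^bsub>F x\<^esub> t x)\<rparr>"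

section \<open>Spectra\<close>

definition frac :: "('a, 'm) ring_scheme \<Rightarrow> 'a set \<Rightarrow> 'a \<Rightarrow> 'a \<Rightarrow> ('a \<times> 'a) set" where
  "frac R p a s = {(b, t). b \<in> carrier R \<and> t \<in> carrier R - p \<and>
     (\<exists>u \<in> carrier R - p. u \<otimes>\<^bsub>R\<^esub> (a \<otimes>\<^bsub>R\<^esub> t) = u \<otimes>\<^bsub>R\<^esub> (b \<otimes>\<^bsub>R\<^esub> s))}"

text \<open>The localization of \<open>R\<close> at the complement of a prime ideal \<open>p\<close>, with operations
  computed on representatives as for \<open>stalk\<close>.\<close>

definition localization :: "('a, 'm) ring_scheme \<Rightarrow> 'a set \<Rightarrow> ('a \<times> 'a) set ring" where
  "localization R p = \<lparr>
     carrier = {frac R p a s | a s. a \<in> carrier R \<and> s \<in> carrier R - p},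
     mult = (\<lambda>\<alpha> \<beta>. \<Union>(a, s) \<in> \<alpha>. \<Union>(b, t) \<in> \<beta>. frac R p (a \<otimes>\<^bsub>R\<^esub> b) (s \<otimes>\<^bsub>R\<^esub> t)),
     one = frac R p \<one>\<^bsub>R\<^esub> \<one>\<^bsub>R\<^esub>,
     zero = frac R p \<zero>\<^bsub>R\<^esub> \<one>\<^bsub>R\<^esub>,
     add = (\<lambda>\<alpha> \<beta>. \<Union>(a, s) \<in> \<alpha>. \<Union>(b, t) \<in> \<beta>.
       frac R p ((a \<otimes>\<^bsub>R\<^esub> t) \<oplus>\<^bsub>R\<^esub> (b \<otimes>\<^bsub>R\<^esub> s)) (s \<otimes>\<^bsub>R\<^esub> t))\<rparr>"

definition zariski_open :: "('a, 'm) ring_scheme \<Rightarrow> 'a set set \<Rightarrow> bool" where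
  "zariski_open R U \<longleftrightarrow> (\<exists>E \<subseteq> carrier R. U = {p. primeideal p R \<and> \<not> E \<subseteq> p})"

definition zariski :: "('a, 'm) ring_scheme \<Rightarrow> 'a set topology" where
  "zariski R = topology (zariski_open R)"

lemma zariski_open_Int:
  assumes "zariski_open R U" and "zariski_open R V"
  shows "zariski_open R (U \<inter> V)"
proof -
  from assms obtain E F where
    E: "E \<subseteq> carrier R" "U = {p. primeideal p R \<and> \<not> E \<subseteq> p}" and
    F: "F \<subseteq> carrier R" "V = {p. primeideal p R \<and> \<not> F \<subseteq> p}"
    unfolding zariski_open_def by blast
  define G where "G = {g \<in> carrier R. \<exists>a \<in> E. \<exists>b \<in> F. g = a \<otimes>\<^bsub>R\<^esub> b}"
  have "(\<not> E \<subseteq> p \<and> \<not> F \<subseteq> p) \<longleftrightarrow> \<not> G \<subseteq> p" if p: "primeideal p R" for p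
  proof -
    interpret primeideal p R by (rule p)
    have "\<not> G \<subseteq> p" if "\<not> E \<subseteq> p" "\<not> F \<subseteq> p"
    proof -
      from that obtain a b where ab: "a \<in> E" "b \<in> F" "a \<notin> p" "b \<notin> p" by blast
      then have c: "a \<in> carrier R" "b \<in> carrier R" using E F by auto
      have "a \<otimes>\<^bsub>R\<^esub> b \<notin> p" using I_prime[OF c] ab by blast
      moreover have "a \<otimes>\<^bsub>R\<^esub> b \<in> G" unfolding G_def using ab c by blast
      ultimately show ?thesis by blast
    qed
    moreover have "G \<subseteq> p" if "E \<subseteq> p \<or> F \<subseteq> p"
    proof
      fix g assume "g \<in> G"
      then obtain a b where "a \<in> E" "b \<in> F" "g = a \<otimes>\<^bsub>R\<^esub> b" unfolding G_def by blast
      then show "g \<in> p" using that E F I_l_closed I_r_closed by blast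
    qed
    ultimately show ?thesis by blast
  qed
  then have "U \<inter> V = {p. primeideal p R \<and> \<not> G \<subseteq> p}" unfolding E F by blast
  moreover have "G \<subseteq> carrier R" unfolding G_def by blast
  ultimately show ?thesis unfolding zariski_open_def by blast
qed

lemma zariski_open_Union:
  assumes "\<And>U. U \<in> \<U> \<Longrightarrow> zariski_open R U"
  shows "zariski_open R (\<Union>\<U>)"
proof -
  have "\<forall>U \<in> \<U>. \<exists>E. E \<subseteq> carrier R \<and> U = {p. primeideal p R \<and> \<not> E \<subseteq> p}"
    using assms unfolding zariski_open_def by blast
  then obtain E where
    E: "\<And>U. U \<in> \<U> \<Longrightarrow> E U \<subseteq> carrier R \<and> U = {p. primeideal p R \<and> \<not> E U \<subseteq> p}"
    by metis
  have "p \<in> \<Union>\<U> \<longleftrightarrow> primeideal p R \<and> \<not> (\<Union>U \<in> \<U>. E U) \<subseteq> p" for p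
  proof
    assume "p \<in> \<Union>\<U>"
    then obtain U where "U \<in> \<U>" "p \<in> U" by blast
    with E[of U] show "primeideal p R \<and> \<not> (\<Union>U \<in> \<U>. E U) \<subseteq> p" by blast
  next
    assume p: "primeideal p R \<and> \<not> (\<Union>U \<in> \<U>. E U) \<subseteq> p"
    then obtain U where U: "U \<in> \<U>" "\<not> E U \<subseteq> p" by blast
    with E[of U] p have "p \<in> U" by blast
    with U show "p \<in> \<Union>\<U>" by blast
  qed
  then have "\<Union>\<U> = {p. primeideal p R \<and> \<not> (\<Union>U \<in> \<U>. E U) \<subseteq> p}" by blast
  moreover have "(\<Union>U \<in> \<U>. E U) \<subseteq> carrier R" using E by blast
  ultimately show ?thesis unfolding zariski_open_def by blast
qed

lemma openin_zariski: "openin (zariski R) = zariski_open R"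
  unfolding zariski_def
  by (rule topology_inverse') (simp add: istopology_def zariski_open_Int zariski_open_Union)

lemma topspace_zariski: "topspace (zariski R) = {p. primeideal p R}"
proof -
  have "p \<in> topspace (zariski R)" if p: "primeideal p R" for p
  proof -
    interpret primeideal p R by (rule p)
    have "\<not> carrier R \<subseteq> p" using I_notcarr a_subset by blast
    then have "p \<in> {p. primeideal p R \<and> \<not> carrier R \<subseteq> p}" using p by blast
    moreover have "openin (zariski R) {p. primeideal p R \<and> \<not> carrier R \<subseteq> p}"
      unfolding openin_zariski zariski_open_def by blast
    ultimately show ?thesis using openin_subset by blast
  qed
  moreover have "primeideal p R" if "p \<in> topspace (zariski R)" for p
    using that unfolding topspace_def openin_zariski zariski_open_def by blast
  ultimately show ?thesis by blast
qed

text \<open>Sections of the structure sheaf over \<open>U\<close>: functions that are locally fractions.\<close>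

definition spec_sections :: "('a, 'm) ring_scheme \<Rightarrow> 'a set set \<Rightarrow> ('a set \<Rightarrow> ('a \<times> 'a) set) set" where
  "spec_sections R U = {s \<in> (\<Pi>\<^sub>E p\<in>U. carrier (localization R p)).
     \<forall>p \<in> U. \<exists>V a f. openin (zariski R) V \<and> p \<in> V \<and> V \<subseteq> U \<and> a \<in> carrier R \<and> f \<in> carrier R \<and>
       (\<forall>q \<in> V. f \<notin> q \<and> s q = frac R q a f)}"

definition Spec :: "('a, 'm) ring_scheme \<Rightarrow> ('a set, 'a set \<Rightarrow> ('a \<times> 'a) set) rspace" where
  "Spec R = \<lparr>
     topo = zariski R,
     sect = (\<lambda>U. fun_ring U (localization R) (spec_sections R U)),
     res = (\<lambda>U V s. restrict s V)\<rparr>"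

section \<open>Schemes\<close>

text \<open>
  The ring \<open>R\<close> is taken over the type of the sections of \<open>X\<close>. This is no restriction: if
  \<open>X\<close> is isomorphic to the spectrum of any ring, then it is isomorphic to the spectrum of its
  ring of global sections.
\<close>

definition affine_scheme :: "('p, 'a) rspace \<Rightarrow> bool" where
  "affine_scheme X \<longleftrightarrow> (\<exists>(R :: 'a ring) \<phi>. cring R \<and> lrs_isomorphism X (Spec R) \<phi>)"

locale scheme = locally_ringed_space +
  assumes locally_affine:
    "x \<in> points X \<Longrightarrow> \<exists>U. is_open X U \<and> x \<in> U \<and> affine_scheme (open_subspace X U)"

section \<open>Closed subschemes\<close>

locale ideal_sheaf = ringed_space +
  fixes I :: "'p set \<Rightarrow> 'a set"
  assumes ideal_sect: "is_open X U \<Longrightarrow> ideal (I U) (sect X U)"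
    and ideal_res: "\<lbrakk>is_open X U; is_open X V; V \<subseteq> U; f \<in> I U\<rbrakk> \<Longrightarrow> res X U V f \<in> I V"
    and ideal_gluing: "\<lbrakk>\<And>V. V \<in> \<U> \<Longrightarrow> is_open X V; f \<in> carrier (sect X (\<Union>\<U>));
        \<And>V. V \<in> \<U> \<Longrightarrow> res X (\<Union>\<U>) V f \<in> I V\<rbrakk> \<Longrightarrow> f \<in> I (\<Union>\<U>)"

definition stalk_ideal ::
  "('p, 'a) rspace \<Rightarrow> ('p set \<Rightarrow> 'a set) \<Rightarrow> 'p \<Rightarrow> ('p set \<times> 'a) set set" where
  "stalk_ideal X I x = {germ X x U f | U f. is_open X U \<and> x \<in> U \<and> f \<in> I U}"

text \<open>
  Each point has an open neighbourhood \<open>U\<close> on which the ideal sheaf is generated, as a sheaf of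
  modules, by its sections over \<open>U\<close>; generation is tested on stalks.
\<close>

definition locally_generated :: "('p, 'a) rspace \<Rightarrow> ('p set \<Rightarrow> 'a set) \<Rightarrow> bool" where
  "locally_generated X I \<longleftrightarrow>
     (\<forall>x \<in> points X. \<exists>U. is_open X U \<and> x \<in> U \<and>
        (\<forall>y \<in> U. stalk_ideal X I y = genideal (stalk X y) (germ X y U ` I U)))"

text \<open>The support of the quotient of the structure sheaf by \<open>I\<close>.\<close>

definition zero_locus :: "('p, 'a) rspace \<Rightarrow> ('p set \<Rightarrow> 'a set) \<Rightarrow> 'p set" where
  "zero_locus X I = {x \<in> points X. stalk_ideal X I x \<noteq> carrier (stalk X x)}"

text \<open>
  The inverse image, along the inclusion of the zero locus, of the quotient of the structure
  sheaf by \<open>I\<close>. Its stalk at \<open>y\<close> is the quotient of the stalk of \<open>X\<close> by the stalk of \<open>I\<close>, and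
  its sections over \<open>W\<close> are the functions into these stalks that are locally induced by
  sections of \<open>X\<close>.
\<close>

definition quotient_sections ::
  "('p, 'a) rspace \<Rightarrow> ('p set \<Rightarrow> 'a set) \<Rightarrow> 'p set \<Rightarrow> ('p \<Rightarrow> ('p set \<times> 'a) set set) set" where
  "quotient_sections X I W =
     {s \<in> (\<Pi>\<^sub>E x\<in>W. carrier (stalk X x Quot stalk_ideal X I x)).
      \<forall>x \<in> W. \<exists>U f. is_open X U \<and> x \<in> U \<and> f \<in> carrier (sect X U) \<and>
        (\<forall>y \<in> U \<inter> W. s y = stalk_ideal X I y +>\<^bsub>stalk X y\<^esub> germ X y U f)}"

definition closed_subspace ::
  "('p, 'a) rspace \<Rightarrow> ('p set \<Rightarrow> 'a set) \<Rightarrow> ('p, 'p \<Rightarrow> ('p set \<times> 'a) set set) rspace" where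
  "closed_subspace X I = \<lparr>
     topo = subtopology (topo X) (zero_locus X I),
     sect = (\<lambda>W. fun_ring W (\<lambda>x. stalk X x Quot stalk_ideal X I x) (quotient_sections X I W)),
     res = (\<lambda>W V s. restrict s V)\<rparr>"

text \<open>
  A closed subscheme of a scheme is the closed subspace cut out by a sheaf of ideals that is
  locally generated by sections (equivalently, on a scheme, quasi-coherent); this is the
  definition of the Stacks project and, with quasi-coherence, of EGA I. Such a closed subspace
  is again a scheme.
\<close>

definition closed_subscheme ::
  "('p, 'a) rspace \<Rightarrow> ('p, 'p \<Rightarrow> ('p set \<times> 'a) set set) rspace \<Rightarrow> bool" where
  "closed_subscheme X Y \<longleftrightarrow>
     (\<exists>I. ideal_sheaf X I \<and> locally_generated X I \<and> Y = closed_subspace X I)"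

section \<open>Properties of points\<close>

definition countable_scheme :: "('p, 'a) rspace \<Rightarrow> bool" where
  "countable_scheme X \<longleftrightarrow> scheme X \<and> countable (points X)"

definition specialization_condition :: "('p, 'a) rspace \<Rightarrow> ('p \<Rightarrow> bool) \<Rightarrow> bool" where
  "specialization_condition X P \<longleftrightarrow>
     (\<forall>s \<in> points X. P s \<longrightarrow> (\<forall>s\<^sub>0 \<in> (topo X) closure_of {s}. P s\<^sub>0))"

definition descends_along ::
  "('p, 'a) rspace \<Rightarrow> ('p, 'a, 'q, 'b) rmorph \<Rightarrow> ('p \<Rightarrow> bool) \<Rightarrow> ('q \<Rightarrow> bool) \<Rightarrow> bool" where
  "descends_along X \<pi> P P' \<longleftrightarrow> (\<forall>s \<in> points X. P s \<longleftrightarrow> P' (base \<pi> s))"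

end

theory Submission
  imports Defs "HOL-Algebra.Ring_Divisibility"
begin

text \<open>
  The points of \<open>S\<close> with property \<open>P\<close> form the union, over the countably many points \<open>t\<close> of \<open>S'\<close>
  with property \<open>P'\<close>, of the preimages of the closures of \<open>{t}\<close>: the specialization condition says
  that these closures stay inside the locus of \<open>P'\<close>. Each preimage is closed, and a closed set \<open>C\<close>
  underlies the reduced closed subscheme cut out by the sections whose germs at the points of \<open>C\<close>
  lie in the maximal ideals.
\<close>

section \<open>Local rings\<close>

text \<open>The difficulty is that a closed subscheme requires a locally generated ideal sheaf.
  Stating vanishing through the maximal ideals of the stalks gives the sheaf axioms and the zero
  locus on any locally ringed space; affine charts enter only for generation. There the obstacle is
  extension: a section vanishing on \<open>C\<close> is given only near one point, while a generator
  must be defined on the whole chart and vanish on \<open>C\<close> everywhere in it. Clearing the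
  denominator extends the section, and a further factor \<open>g\<close> forces it to vanish outside
  the basic open set on which the original section is known. Questions about germs in a chart are
  reduced to equations between sections over an open set, carried to the spectrum by the bijection
  \<open>comorph \<phi> V\<close> and evaluated at a prime.\<close>

lemma (in cring) maximalideal_over_proper_ideal:
  assumes J: "ideal J R" "J \<noteq> carrier R"
  shows "\<exists>M. maximalideal M R \<and> J \<subseteq> M"
proof -
  \<comment> \<open>Properness is recorded as \<open>\<one> \<notin> K\<close>, a condition that
    passes to unions of chains.\<close>
  define A where "A = {K. ideal K R \<and> J \<subseteq> K \<and> \<one> \<notin> K}"
  have "\<one> \<notin> J" using J ideal.one_imp_carrier by blast
  then have "J \<in> A" using J by (simp add: A_def)
  have "\<Union>\<C> \<in> A" if ne: "\<C> \<noteq> {}" and ch: "subset.chain A \<C>" for \<C>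
  proof -
    have sub: "\<C> \<subseteq> A" using ch by (simp add: subset.chain_def)
    have "subset.chain {I. ideal I R} \<C>"
      using ch unfolding subset.chain_def A_def by blast
    then have "ideal (\<Union>\<C>) R" using chain_Union_is_ideal[of \<C>] ne by simp
    then show ?thesis using sub ne unfolding A_def by blast
  qed
  then obtain M where M: "M \<in> A" and max: "\<And>K. K \<in> A \<Longrightarrow> M \<subseteq> K \<Longrightarrow> K = M"
    using subset_Zorn_nonempty[of A] \<open>J \<in> A\<close> by blast
  have "maximalideal M R"
  proof (rule maximalidealI)
    show "ideal M R" "carrier R \<noteq> M" using M by (auto simp: A_def)
    fix K assume K: "ideal K R" "M \<subseteq> K" "K \<subseteq> carrier R"
    show "K = M \<or> K = carrier R"
    proof (cases "\<one> \<in> K")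
      case True then show ?thesis using K ideal.one_imp_carrier by blast
    next
      case False
      then have "K \<in> A" using K M by (auto simp: A_def)
      then show ?thesis using max K by blast
    qed
  qed
  then show ?thesis using M by (auto simp: A_def)
qed

lemma maximalideal_max_ideal:
  assumes "local_ring R"
  shows "maximalideal (max_ideal R) R"
  unfolding max_ideal_def by (rule theI') (use assms in \<open>simp add: local_ring_def\<close>)

text \<open>The principal ideal of a nonunit is proper, so it lies in a maximal ideal, and there is
  only one. Membership in the maximal ideal thus becomes the absence of an inverse, a matter of
  equations.\<close>

lemma nonunit_in_max_ideal:
  fixes R (structure)
  assumes R: "local_ring R" and a: "a \<in> carrier R"
    and nonunit: "\<And>b. b \<in> carrier R \<Longrightarrow> a \<otimes> b \<noteq> \<one>"
  shows "a \<in> max_ideal R"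
proof -
  interpret cring R using R by (simp add: local_ring_def)
  have id: "ideal (PIdl a) R" using a by (rule cgenideal_ideal)
  have "\<one> \<notin> PIdl a"
  proof
    assume "\<one> \<in> PIdl a"
    then obtain b where b: "b \<in> carrier R" "\<one> = b \<otimes> a" by (auto simp: cgenideal_def)
    then show False using nonunit[OF b(1)] a m_comm by simp
  qed
  then have "PIdl a \<noteq> carrier R" by auto
  then obtain M where "maximalideal M R" "PIdl a \<subseteq> M"
    using maximalideal_over_proper_ideal[OF id] by blast
  moreover have "max_ideal R = M"
    using R \<open>maximalideal M R\<close> maximalideal_max_ideal[OF R] unfolding local_ring_def by blast
  ultimately show ?thesis using cgenideal_self[OF a] by blast
qed

section \<open>Germs\<close>

context ringed_space
begin

lemma res_closed:
  "\<lbrakk>is_open X U; is_open X V; V \<subseteq> U; f \<in> carrier (sect X U)\<rbrakk>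
    \<Longrightarrow> res X U V f \<in> carrier (sect X V)"
  using res_hom ring_hom_closed by metis

text \<open>Agreement near \<open>x\<close> is transitive: two witnessing neighbourhoods are
  intersected. One inclusion suffices, since the hypotheses are symmetric and exchanging the roles
  gives equality.\<close>

lemma germ_subset:
  assumes "is_open X U" "is_open X V" "is_open X W" "x \<in> W" "W \<subseteq> U \<inter> V"
    and f: "f \<in> carrier (sect X U)" and g: "g \<in> carrier (sect X V)"
    and eq: "res X U W f = res X V W g"
  shows "germ X x U f \<subseteq> germ X x V g"
proof
  fix p assume "p \<in> germ X x U f"
  then obtain T h W' where p: "p = (T, h)" and T: "is_open X T" "x \<in> T" "h \<in> carrier (sect X T)"
    and W': "is_open X W'" "x \<in> W'" "W' \<subseteq> U \<inter> T" "res X U W' f = res X T W' h"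
    unfolding germ_def by blast
  have o: "is_open X (W \<inter> W')" using assms W' by blast
  have "res X V (W \<inter> W') g = res X W (W \<inter> W') (res X V W g)"
    using res_res[of V W "W \<inter> W'" g] assms o by auto
  also have "\<dots> = res X U (W \<inter> W') f"
    using res_res[of U W "W \<inter> W'" f] assms(1-7) o unfolding eq[symmetric] by auto
  also have "\<dots> = res X W' (W \<inter> W') (res X T W' h)"
    using res_res[of U W' "W \<inter> W'" f] assms o W' by auto
  also have "\<dots> = res X T (W \<inter> W') h"
    using res_res[of T W' "W \<inter> W'" h] T o W' by auto
  finally have e: "res X V (W \<inter> W') g = res X T (W \<inter> W') h" .
  have "x \<in> W \<inter> W'" "W \<inter> W' \<subseteq> V \<inter> T" using assms W' by auto
  then show "p \<in> germ X x V g"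
    unfolding germ_def p using T o e by blast
qed

lemma germ_eqI:
  assumes "is_open X U" "is_open X V" "is_open X W" "x \<in> W" "W \<subseteq> U \<inter> V"
    and "f \<in> carrier (sect X U)" and "g \<in> carrier (sect X V)"
    and "res X U W f = res X V W g"
  shows "germ X x U f = germ X x V g"
proof
  show "germ X x U f \<subseteq> germ X x V g" using assms by (rule germ_subset)
  show "germ X x V g \<subseteq> germ X x U f" by (rule germ_subset[of V U W]) (use assms in auto)
qed

lemma germ_res:
  assumes "is_open X U" "is_open X V" "V \<subseteq> U" "x \<in> V" "f \<in> carrier (sect X U)"
  shows "germ X x V (res X U V f) = germ X x U f"
  by (rule germ_eqI[of V U V]) (use assms in \<open>auto simp: res_closed res_id\<close>)

lemma germ_self:
  assumes "is_open X U" "x \<in> U" "f \<in> carrier (sect X U)"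
  shows "(U, f) \<in> germ X x U f"
  using assms unfolding germ_def by blast

lemma mem_germD:
  assumes "(V, g) \<in> germ X x U f"
  obtains W where "is_open X V" "x \<in> V" "g \<in> carrier (sect X V)"
    "is_open X W" "x \<in> W" "W \<subseteq> U \<inter> V" "res X U W f = res X V W g"
  using assms unfolding germ_def by blast

lemma germ_eqD:
  assumes "germ X x U f = germ X x V g" "is_open X V" "x \<in> V" "g \<in> carrier (sect X V)"
  obtains W where "is_open X W" "x \<in> W" "W \<subseteq> U \<inter> V" "res X U W f = res X V W g"
proof -
  have "(V, g) \<in> germ X x U f" using germ_self assms by simp
  then show thesis using that by (elim mem_germD) blast
qed

text \<open>Treats addition and multiplication of germs at once. An operation that commutes with
  restriction gives the same germ for all representatives, because both choices agree on the
  intersection of the neighbourhoods \<open>A\<close> and \<open>B\<close> on which the factors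
  agree. The argument \<open>W\<close> of \<open>oper\<close> is there because the ring structure
  depends on the open set.\<close>

lemma germ_binop:
  assumes closed: "\<And>W f g. \<lbrakk>is_open X W; f \<in> carrier (sect X W); g \<in> carrier (sect X W)\<rbrakk>
      \<Longrightarrow> oper W f g \<in> carrier (sect X W)"
    and res_oper: "\<And>V W f g. \<lbrakk>is_open X V; is_open X W; W \<subseteq> V; f \<in> carrier (sect X V);
        g \<in> carrier (sect X V)\<rbrakk> \<Longrightarrow> res X V W (oper V f g) = oper W (res X V W f) (res X V W g)"
    and U: "is_open X U" "x \<in> U" "f \<in> carrier (sect X U)"
    and V: "is_open X V" "x \<in> V" "g \<in> carrier (sect X V)"
  shows "(\<Union>(U', f') \<in> germ X x U f. \<Union>(V', g') \<in> germ X x V g.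
      germ X x (U' \<inter> V') (oper (U' \<inter> V') (res X U' (U' \<inter> V') f') (res X V' (U' \<inter> V') g')))
    = germ X x (U \<inter> V) (oper (U \<inter> V) (res X U (U \<inter> V) f) (res X V (U \<inter> V) g))"
    (is "?L = ?R")
proof -
  have *: "germ X x (U' \<inter> V') (oper (U' \<inter> V') (res X U' (U' \<inter> V') f') (res X V' (U' \<inter> V') g')) = ?R"
    if f': "(U', f') \<in> germ X x U f" and g': "(V', g') \<in> germ X x V g" for U' f' V' g'
  proof -
    from f' obtain A where A: "is_open X U'" "x \<in> U'" "f' \<in> carrier (sect X U')"
      "is_open X A" "x \<in> A" "A \<subseteq> U \<inter> U'" "res X U A f = res X U' A f'" by (rule mem_germD)
    from g' obtain B where B: "is_open X V'" "x \<in> V'" "g' \<in> carrier (sect X V')"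
      "is_open X B" "x \<in> B" "B \<subseteq> V \<inter> V'" "res X V B g = res X V' B g'" by (rule mem_germD)
    have o: "is_open X (A \<inter> B)" "is_open X (U \<inter> V)" "is_open X (U' \<inter> V')"
      using A B U V by blast+
    have sub: "A \<inter> B \<subseteq> U \<inter> V" "A \<inter> B \<subseteq> U' \<inter> V'" using A B by auto
    have "res X (U \<inter> V) (A \<inter> B) (res X U (U \<inter> V) f) = res X A (A \<inter> B) (res X U A f)"
      using res_res[of U A "A \<inter> B" f] res_res[of U "U \<inter> V" "A \<inter> B" f] A B U V o sub by simp
    also have "\<dots> = res X (U' \<inter> V') (A \<inter> B) (res X U' (U' \<inter> V') f')"
      using res_res[of U' A "A \<inter> B" f'] res_res[of U' "U' \<inter> V'" "A \<inter> B" f'] A B o sub by simp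
    finally have 1: "res X (U \<inter> V) (A \<inter> B) (res X U (U \<inter> V) f)
      = res X (U' \<inter> V') (A \<inter> B) (res X U' (U' \<inter> V') f')" .
    have "res X (U \<inter> V) (A \<inter> B) (res X V (U \<inter> V) g) = res X B (A \<inter> B) (res X V B g)"
      using res_res[of V B "A \<inter> B" g] res_res[of V "U \<inter> V" "A \<inter> B" g] A B U V o sub by simp
    also have "\<dots> = res X (U' \<inter> V') (A \<inter> B) (res X V' (U' \<inter> V') g')"
      using res_res[of V' B "A \<inter> B" g'] res_res[of V' "U' \<inter> V'" "A \<inter> B" g'] A B o sub by simp
    finally have 2: "res X (U \<inter> V) (A \<inter> B) (res X V (U \<inter> V) g)
      = res X (U' \<inter> V') (A \<inter> B) (res X V' (U' \<inter> V') g')" .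
    have c: "res X U (U \<inter> V) f \<in> carrier (sect X (U \<inter> V))"
      "res X V (U \<inter> V) g \<in> carrier (sect X (U \<inter> V))"
      "res X U' (U' \<inter> V') f' \<in> carrier (sect X (U' \<inter> V'))"
      "res X V' (U' \<inter> V') g' \<in> carrier (sect X (U' \<inter> V'))"
      using A B U V o by (auto intro!: res_closed)
    show ?thesis
      by (rule germ_eqI[of _ _ "A \<inter> B"]) (use o c sub A B 1 2 in \<open>auto simp: closed res_oper\<close>)
  qed
  have "?L \<subseteq> ?R" using * by auto
  \<comment> \<open>A union of copies of one set is that set only if the index sets are nonempty;
    the given representatives witness this.\<close>
  moreover have "?R \<subseteq> ?L" using germ_self[OF U] germ_self[OF V] by blast
  ultimately show ?thesis by blast
qed

lemma stalk_mult_germ: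
  assumes U: "is_open X U" "x \<in> U" "f \<in> carrier (sect X U)"
    and V: "is_open X V" "x \<in> V" "g \<in> carrier (sect X V)"
  shows "germ X x U f \<otimes>\<^bsub>stalk X x\<^esub> germ X x V g
    = germ X x (U \<inter> V) (res X U (U \<inter> V) f \<otimes>\<^bsub>sect X (U \<inter> V)\<^esub> res X V (U \<inter> V) g)"
proof -
  have "f \<otimes>\<^bsub>sect X W\<^esub> g \<in> carrier (sect X W)"
    if "is_open X W" "f \<in> carrier (sect X W)" "g \<in> carrier (sect X W)" for W f g
    using that by (intro cring.cring_simprules(5) sect_cring)
  moreover have "res X V W (f \<otimes>\<^bsub>sect X V\<^esub> g) = res X V W f \<otimes>\<^bsub>sect X W\<^esub> res X V W g"
    if "is_open X V" "is_open X W" "W \<subseteq> V" "f \<in> carrier (sect X V)" "g \<in> carrier (sect X V)"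
    for V W f g
    using that by (intro ring_hom_mult res_hom)
  ultimately show ?thesis
    using germ_binop[OF _ _ U V, of "\<lambda>W f g. f \<otimes>\<^bsub>sect X W\<^esub> g"] by (simp add: stalk_def)
qed

lemma stalk_add_germ:
  assumes U: "is_open X U" "x \<in> U" "f \<in> carrier (sect X U)"
    and V: "is_open X V" "x \<in> V" "g \<in> carrier (sect X V)"
  shows "germ X x U f \<oplus>\<^bsub>stalk X x\<^esub> germ X x V g
    = germ X x (U \<inter> V) (res X U (U \<inter> V) f \<oplus>\<^bsub>sect X (U \<inter> V)\<^esub> res X V (U \<inter> V) g)"
proof -
  have "f \<oplus>\<^bsub>sect X W\<^esub> g \<in> carrier (sect X W)"
    if "is_open X W" "f \<in> carrier (sect X W)" "g \<in> carrier (sect X W)" for W f g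
    using that by (intro cring.cring_simprules(1) sect_cring)
  moreover have "res X V W (f \<oplus>\<^bsub>sect X V\<^esub> g) = res X V W f \<oplus>\<^bsub>sect X W\<^esub> res X V W g"
    if "is_open X V" "is_open X W" "W \<subseteq> V" "f \<in> carrier (sect X V)" "g \<in> carrier (sect X V)"
    for V W f g
    using that by (intro ring_hom_add res_hom)
  ultimately show ?thesis
    using germ_binop[OF _ _ U V, of "\<lambda>W f g. f \<oplus>\<^bsub>sect X W\<^esub> g"] by (simp add: stalk_def)
qed

lemma stalk_carrierE:
  assumes "\<alpha> \<in> carrier (stalk X x)"
  obtains U f where "is_open X U" "x \<in> U" "f \<in> carrier (sect X U)" "\<alpha> = germ X x U f"
  using assms by (auto simp: stalk_def)

lemma germ_ring_hom:
  assumes U: "is_open X U" "x \<in> U"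
  shows "germ X x U \<in> ring_hom (sect X U) (stalk X x)"
proof (rule ring_hom_memI)
  interpret sU: cring "sect X U" using U sect_cring by blast
  interpret sX: cring "sect X (points X)" using sect_cring by blast
  show "germ X x U f \<in> carrier (stalk X x)" if "f \<in> carrier (sect X U)" for f
    using that U by (auto simp: stalk_def)
  show "germ X x U (f \<otimes>\<^bsub>sect X U\<^esub> g) = germ X x U f \<otimes>\<^bsub>stalk X x\<^esub> germ X x U g"
    "germ X x U (f \<oplus>\<^bsub>sect X U\<^esub> g) = germ X x U f \<oplus>\<^bsub>stalk X x\<^esub> germ X x U g"
    if "f \<in> carrier (sect X U)" "g \<in> carrier (sect X U)" for f g
    using that U by (simp_all add: stalk_mult_germ stalk_add_germ res_id)
  \<comment> \<open>The unit of the stalk is by definition the germ of the global unit, so it is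
    compared with the unit over \<open>U\<close> by restricting from the whole space.\<close>
  have "U \<subseteq> points X" using U openin_subset by blast
  then have "germ X x U (res X (points X) U \<one>\<^bsub>sect X (points X)\<^esub>)
      = germ X x (points X) \<one>\<^bsub>sect X (points X)\<^esub>"
    using U by (intro germ_res) auto
  then show "germ X x U \<one>\<^bsub>sect X U\<^esub> = \<one>\<^bsub>stalk X x\<^esub>"
    using ring_hom_one[OF res_hom, of "points X" U] U \<open>U \<subseteq> points X\<close> by (simp add: stalk_def)
qed

end

section \<open>Fractions\<close>

context primeideal
begin

lemma one_not_mem: "\<one> \<notin> I"
  using I_notcarr one_imp_carrier by blast

lemma mult_not_mem:
  assumes "s \<in> carrier R - I" "t \<in> carrier R - I"
  shows "s \<otimes> t \<in> carrier R - I"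
  using assms I_prime by auto

text \<open>Transitivity of equality of fractions in a ring that may have zero divisors: if
  \<open>u\<close> witnesses the first equality and \<open>v\<close> the second, then
  \<open>(u \<otimes> v) \<otimes> s\<close> witnesses the composite, and it avoids \<open>I\<close>
  because \<open>I\<close> is prime.\<close>

lemma frac_subset:
  assumes "a \<in> carrier R" "b \<in> carrier R" "s \<in> carrier R - I" "t \<in> carrier R - I"
    "u \<in> carrier R - I" and eq: "u \<otimes> (a \<otimes> t) = u \<otimes> (b \<otimes> s)"
  shows "frac R I a s \<subseteq> frac R I b t"
proof
  fix p assume "p \<in> frac R I a s"
  then obtain c w v where p: "p = (c, w)" and c: "c \<in> carrier R" "w \<in> carrier R - I"
    and v: "v \<in> carrier R - I" "v \<otimes> (a \<otimes> w) = v \<otimes> (c \<otimes> s)"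
    unfolding frac_def by blast
  note carr = assms(1-5) c v(1)
  have "((u \<otimes> v) \<otimes> s) \<otimes> (b \<otimes> w) = (v \<otimes> w) \<otimes> (u \<otimes> (b \<otimes> s))"
    using carr by (simp add: m_ac)
  also have "\<dots> = (u \<otimes> t) \<otimes> (v \<otimes> (a \<otimes> w))"
    unfolding eq[symmetric] using carr by (simp add: m_ac)
  also have "\<dots> = ((u \<otimes> v) \<otimes> s) \<otimes> (c \<otimes> t)"
    unfolding v(2) using carr by (simp add: m_ac)
  finally have e: "((u \<otimes> v) \<otimes> s) \<otimes> (b \<otimes> w) = ((u \<otimes> v) \<otimes> s) \<otimes> (c \<otimes> t)" .
  have "(u \<otimes> v) \<otimes> s \<in> carrier R - I" by (intro mult_not_mem carr)
  then show "p \<in> frac R I b t" unfolding frac_def p using c e by blast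
qed

lemma frac_eqI:
  assumes "a \<in> carrier R" "b \<in> carrier R" "s \<in> carrier R - I" "t \<in> carrier R - I"
    "u \<in> carrier R - I" and eq: "u \<otimes> (a \<otimes> t) = u \<otimes> (b \<otimes> s)"
  shows "frac R I a s = frac R I b t"
  using frac_subset[OF assms] frac_subset[OF assms(2,1,4,3,5) eq[symmetric]] by blast

lemma frac_self:
  assumes "a \<in> carrier R" "s \<in> carrier R - I"
  shows "(a, s) \<in> frac R I a s"
  using assms one_not_mem unfolding frac_def by blast

text \<open>The product of the witnesses for the two factors is a witness for the product, so the
  union over representatives collapses to one fraction.\<close>

lemma localization_mult_frac:
  assumes a: "a \<in> carrier R" "s \<in> carrier R - I" and b: "b \<in> carrier R" "t \<in> carrier R - I"
  shows "frac R I a s \<otimes>\<^bsub>localization R I\<^esub> frac R I b t = frac R I (a \<otimes> b) (s \<otimes> t)"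
proof -
  have *: "frac R I (a' \<otimes> b') (s' \<otimes> t') = frac R I (a \<otimes> b) (s \<otimes> t)"
    if 1: "(a', s') \<in> frac R I a s" and 2: "(b', t') \<in> frac R I b t" for a' s' b' t'
  proof -
    from 1 obtain u where u: "a' \<in> carrier R" "s' \<in> carrier R - I" "u \<in> carrier R - I"
      and eu: "u \<otimes> (a \<otimes> s') = u \<otimes> (a' \<otimes> s)" unfolding frac_def by blast
    from 2 obtain v where v: "b' \<in> carrier R" "t' \<in> carrier R - I" "v \<in> carrier R - I"
      and ev: "v \<otimes> (b \<otimes> t') = v \<otimes> (b' \<otimes> t)" unfolding frac_def by blast
    have "(u \<otimes> v) \<otimes> ((a' \<otimes> b') \<otimes> (s \<otimes> t)) = (u \<otimes> (a' \<otimes> s)) \<otimes> (v \<otimes> (b' \<otimes> t))"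
      using a b u v by (simp add: m_ac)
    also have "\<dots> = (u \<otimes> v) \<otimes> ((a \<otimes> b) \<otimes> (s' \<otimes> t'))"
      unfolding eu[symmetric] ev[symmetric] using a b u v by (simp add: m_ac)
    finally have e: "(u \<otimes> v) \<otimes> ((a' \<otimes> b') \<otimes> (s \<otimes> t)) = (u \<otimes> v) \<otimes> ((a \<otimes> b) \<otimes> (s' \<otimes> t'))" .
    show ?thesis
      using frac_eqI[OF _ _ _ _ _ e] mult_not_mem a b u v by simp
  qed
  have "(\<Union>(a', s') \<in> frac R I a s. \<Union>(b', t') \<in> frac R I b t. frac R I (a' \<otimes> b') (s' \<otimes> t'))
    = frac R I (a \<otimes> b) (s \<otimes> t)" (is "?L = ?R")
  proof
    show "?L \<subseteq> ?R" using * by auto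
    show "?R \<subseteq> ?L" using frac_self[OF a] frac_self[OF b] by blast
  qed
  then show ?thesis by (simp add: localization_def)
qed

text \<open>An inverse \<open>b/t\<close> of \<open>a/1\<close> would give
  \<open>v a b = v t\<close> with \<open>v\<close> and \<open>t\<close> outside \<open>I\<close>;
  for \<open>a\<close> in \<open>I\<close> the left side lies in \<open>I\<close> and the right side
  does not.\<close>

lemma frac_unit_imp_not_mem:
  assumes a: "a \<in> carrier R" and \<beta>: "\<beta> \<in> carrier (localization R I)"
    and eq: "frac R I a \<one> \<otimes>\<^bsub>localization R I\<^esub> \<beta> = \<one>\<^bsub>localization R I\<^esub>"
  shows "a \<notin> I"
proof
  assume aI: "a \<in> I"
  obtain b t where b: "b \<in> carrier R" "t \<in> carrier R - I" "\<beta> = frac R I b t"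
    using \<beta> by (auto simp: localization_def)
  have one: "\<one> \<in> carrier R - I" using one_not_mem by simp
  have "frac R I (a \<otimes> b) (\<one> \<otimes> t) = frac R I \<one> \<one>"
    using eq b localization_mult_frac[OF a one b(1,2)] by (simp add: localization_def)
  then have "(\<one>, \<one>) \<in> frac R I (a \<otimes> b) (\<one> \<otimes> t)" using frac_self[of \<one> \<one>] one by auto
  then obtain v where v: "v \<in> carrier R - I" "v \<otimes> ((a \<otimes> b) \<otimes> \<one>) = v \<otimes> (\<one> \<otimes> (\<one> \<otimes> t))"
    unfolding frac_def by blast
  have "v \<otimes> ((a \<otimes> b) \<otimes> \<one>) \<in> I"
    using aI b v(1) by (blast intro: I_l_closed I_r_closed one_closed)
  moreover have "v \<otimes> t \<notin> I" using mult_not_mem[of v t] v b by blast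
  ultimately show False using v b by simp
qed

end

section \<open>Fractions as sections over open sets of a spectrum\<close>

definition frac_section :: "('a, 'm) ring_scheme \<Rightarrow> 'a set set \<Rightarrow> 'a \<Rightarrow> 'a \<Rightarrow> 'a set \<Rightarrow> ('a \<times> 'a) set" where
  "frac_section R V a s = (\<lambda>q\<in>V. frac R q a s)"

lemma frac_section_closed:
  assumes V: "openin (zariski R) V" and a: "a \<in> carrier R" "s \<in> carrier R"
    and s: "\<And>q. q \<in> V \<Longrightarrow> s \<notin> q"
  shows "frac_section R V a s \<in> carrier (sect (Spec R) V)"
  using assms by (auto simp: Spec_def fun_ring_def spec_sections_def frac_section_def localization_def)

lemma frac_section_mult:
  assumes V: "openin (zariski R) V" and a: "a \<in> carrier R" "s \<in> carrier R"
    and s: "\<And>q. q \<in> V \<Longrightarrow> s \<notin> q" and b: "b \<in> carrier R" "t \<in> carrier R"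
    and t: "\<And>q. q \<in> V \<Longrightarrow> t \<notin> q"
  shows "frac_section R V a s \<otimes>\<^bsub>sect (Spec R) V\<^esub> frac_section R V b t
    = frac_section R V (a \<otimes>\<^bsub>R\<^esub> b) (s \<otimes>\<^bsub>R\<^esub> t)"
proof -
  have "primeideal q R" if "q \<in> V" for q
    using V that openin_subset[of "zariski R" V] topspace_zariski by fastforce
  then show ?thesis
    using assms primeideal.localization_mult_frac
    by (fastforce simp: Spec_def fun_ring_def frac_section_def restrict_def)
qed

lemma frac_section_eqI:
  assumes V: "openin (zariski R) V" and a: "a \<in> carrier R" "s \<in> carrier R"
    and s: "\<And>q. q \<in> V \<Longrightarrow> s \<notin> q" and b: "b \<in> carrier R" "t \<in> carrier R"
    and t: "\<And>q. q \<in> V \<Longrightarrow> t \<notin> q" and eq: "a \<otimes>\<^bsub>R\<^esub> t = b \<otimes>\<^bsub>R\<^esub> s"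
  shows "frac_section R V a s = frac_section R V b t"
proof -
  have "frac R q a s = frac R q b t" if q: "q \<in> V" for q
  proof -
    interpret primeideal q R
      using V q openin_subset[of "zariski R" V] topspace_zariski by fastforce
    show ?thesis
      by (rule frac_eqI[where u = "\<one>\<^bsub>R\<^esub>"]) (use assms q one_not_mem in auto)
  qed
  then show ?thesis by (simp add: frac_section_def restrict_def fun_eq_iff)
qed

lemma restrict_frac_section:
  "W \<subseteq> V \<Longrightarrow> restrict (frac_section R V a s) W = frac_section R W a s"
  by (auto simp: frac_section_def restrict_def fun_eq_iff)

section \<open>Affine charts\<close>

text \<open>An open subspace keeps \<open>sect\<close> and \<open>res\<close> of \<open>X\<close>,
  so germs and stalks at points of \<open>U\<close> are taken in \<open>X\<close> itself, and the
  chart supplies only a description of sections over open subsets of \<open>U\<close>.\<close>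

locale affine_chart = locally_ringed_space X for X :: "('p, 'a) rspace" +
  fixes U :: "'p set" and R :: "'r ring"
    and \<phi> :: "('p, 'a, 'r set, 'r set \<Rightarrow> ('r \<times> 'r) set) rmorph"
  assumes U_open: "is_open X U"
    and R_cring: "cring R"
    and chart_iso: "lrs_isomorphism (open_subspace X U) (Spec R) \<phi>"
begin

sublocale R: cring R by (rule R_cring)

abbreviation chart_preim :: "'r set set \<Rightarrow> 'p set" where
  "chart_preim V \<equiv> preim (open_subspace X U) \<phi> V"

lemma points_chart: "points (open_subspace X U) = U"
  using openin_subset[OF U_open] by (auto simp: open_subspace_def)

lemma points_Spec: "points (Spec R) = {p. primeideal p R}"
  by (simp add: Spec_def topspace_zariski)

lemma is_open_Spec: "is_open (Spec R) V \<longleftrightarrow> openin (zariski R) V"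
  by (simp add: Spec_def)

lemma is_open_chart: "is_open (open_subspace X U) W \<longleftrightarrow> is_open X W \<and> W \<subseteq> U"
  using openin_open_subtopology[OF U_open] by (simp add: open_subspace_def)

lemma chart_morphism: "lrs_morphism (open_subspace X U) (Spec R) \<phi>"
  and chart_homeo: "homeomorphic_map (topo (open_subspace X U)) (topo (Spec R)) (base \<phi>)"
  using chart_iso unfolding lrs_isomorphism_def by auto

lemma chart_ring_iso:
  "openin (zariski R) V \<Longrightarrow> comorph \<phi> V \<in> ring_iso (sect (Spec R) V) (sect X (chart_preim V))"
  using chart_iso unfolding lrs_isomorphism_def by (simp add: is_open_Spec open_subspace_def)

lemma chart_hom:
  "openin (zariski R) V \<Longrightarrow> comorph \<phi> V \<in> ring_hom (sect (Spec R) V) (sect X (chart_preim V))"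
  using chart_ring_iso by (auto simp: ring_iso_def)

lemma chart_bij:
  "openin (zariski R) V
    \<Longrightarrow> bij_betw (comorph \<phi> V) (carrier (sect (Spec R) V)) (carrier (sect X (chart_preim V)))"
  using chart_ring_iso by (auto simp: ring_iso_def)

lemma chart_surj:
  assumes "openin (zariski R) V" "f \<in> carrier (sect X (chart_preim V))"
  obtains \<tau> where "\<tau> \<in> carrier (sect (Spec R) V)" "f = comorph \<phi> V \<tau>"
  using bij_betw_imp_surj_on[OF chart_bij[OF assms(1)]] assms(2) by blast

lemma chart_res:
  assumes "openin (zariski R) V" "openin (zariski R) W" "W \<subseteq> V" "\<tau> \<in> carrier (sect (Spec R) V)"
  shows "res X (chart_preim V) (chart_preim W) (comorph \<phi> V \<tau>) = comorph \<phi> W (restrict \<tau> W)"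
proof -
  have "res (open_subspace X U) (chart_preim V) (chart_preim W) (comorph \<phi> V \<tau>)
      = comorph \<phi> W (res (Spec R) V W \<tau>)"
    using chart_morphism assms unfolding lrs_morphism_def by (simp add: is_open_Spec)
  then show ?thesis by (simp add: open_subspace_def Spec_def)
qed

lemma chart_base: "x \<in> U \<Longrightarrow> primeideal (base \<phi> x) R"
  using homeomorphic_imp_surjective_map[OF chart_homeo] points_chart points_Spec by auto

lemma mem_chart_preim: "x \<in> chart_preim V \<longleftrightarrow> x \<in> U \<and> base \<phi> x \<in> V"
  by (simp add: preim_def points_chart)

lemma chart_preim_mono: "V \<subseteq> W \<Longrightarrow> chart_preim V \<subseteq> chart_preim W"
  by (auto simp: mem_chart_preim)

lemma chart_preim_open:
  assumes "openin (zariski R) V"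
  shows "is_open X (chart_preim V)"
proof -
  have "continuous_map (topo (open_subspace X U)) (topo (Spec R)) (base \<phi>)"
    using chart_morphism by (simp add: lrs_morphism_def)
  then have "is_open (open_subspace X U) (chart_preim V)"
    using assms unfolding preim_def by (simp add: openin_continuous_map_preimage is_open_Spec)
  then show ?thesis by (simp add: is_open_chart)
qed

lemma chart_preim_Spec: "chart_preim {p. primeideal p R} = U"
  using chart_base by (auto simp: mem_chart_preim)

lemma Spec_open: "openin (zariski R) {p. primeideal p R}"
  using openin_topspace[of "zariski R"] by (simp add: topspace_zariski)

text \<open>A homeomorphism is open and injective, so \<open>W\<close> is the preimage of its own
  image. Every neighbourhood inside the chart can therefore be described on the spectrum.\<close>

lemma open_eq_chart_preim:
  assumes "is_open X W" "W \<subseteq> U"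
  obtains V where "openin (zariski R) V" "W = chart_preim V"
proof
  have "is_open (Spec R) (base \<phi> ` W)"
    using homeomorphic_imp_open_map[OF chart_homeo] assms
    by (simp add: open_map_def is_open_chart)
  then show "openin (zariski R) (base \<phi> ` W)" by (simp add: is_open_Spec)
  have "inj_on (base \<phi>) U"
    using homeomorphic_imp_injective_map[OF chart_homeo] by (simp add: points_chart)
  then show "W = chart_preim (base \<phi> ` W)"
    using assms(2) inj_on_image_mem_iff[of "base \<phi>" U _ W] unfolding set_eq_iff mem_chart_preim by blast
qed

text \<open>The element \<open>a\<close> of \<open>R\<close> read as a function on the chart: the
  section \<open>a/1\<close> of the spectrum, transported to \<open>U\<close>.\<close>

definition global_section :: "'r \<Rightarrow> 'a" where
  "global_section a = comorph \<phi> {p. primeideal p R} (frac_section R {p. primeideal p R} a \<one>\<^bsub>R\<^esub>)"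

lemma one_not_mem_point: "openin (zariski R) V \<Longrightarrow> q \<in> V \<Longrightarrow> \<one>\<^bsub>R\<^esub> \<notin> q"
  using openin_subset[of "zariski R" V] primeideal.one_not_mem by (auto simp: topspace_zariski)

lemma global_section_closed:
  assumes "a \<in> carrier R"
  shows "global_section a \<in> carrier (sect X U)"
proof -
  have "frac_section R {p. primeideal p R} a \<one>\<^bsub>R\<^esub> \<in> carrier (sect (Spec R) {p. primeideal p R})"
    using assms Spec_open one_not_mem_point[OF Spec_open] by (intro frac_section_closed) auto
  from ring_hom_closed[OF chart_hom[OF Spec_open] this] show ?thesis
    by (simp add: global_section_def chart_preim_Spec)
qed

lemma res_global_section:
  assumes "a \<in> carrier R" and V: "openin (zariski R) V"
  shows "res X U (chart_preim V) (global_section a) = comorph \<phi> V (frac_section R V a \<one>\<^bsub>R\<^esub>)"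
proof -
  have sub: "V \<subseteq> {p. primeideal p R}"
    using openin_subset[OF V] by (simp add: topspace_zariski)
  have "frac_section R {p. primeideal p R} a \<one>\<^bsub>R\<^esub> \<in> carrier (sect (Spec R) {p. primeideal p R})"
    using assms Spec_open one_not_mem_point[OF Spec_open] by (intro frac_section_closed) auto
  from chart_res[OF Spec_open V sub this] show ?thesis
    by (simp add: global_section_def chart_preim_Spec restrict_frac_section[OF sub])
qed

text \<open>An inverse of the germ would be an inverse of the section \<open>a/1\<close> over some
  open \<open>V\<close> of the spectrum, and evaluation at the prime \<open>base \<phi> x\<close>
  would make \<open>a/1\<close> invertible in the localization there, although \<open>a\<close> lies
  in that prime.\<close>

lemma germ_global_section_in_max_ideal:
  assumes x: "x \<in> U" and a: "a \<in> base \<phi> x"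
  shows "germ X x U (global_section a) \<in> max_ideal (stalk X x)"
proof (rule nonunit_in_max_ideal)
  interpret p: primeideal "base \<phi> x" R using x by (rule chart_base)
  have aR: "a \<in> carrier R" using a by (rule p.a_Hcarr)
  have xX: "x \<in> points X" using x U_open openin_subset by blast
  then show "local_ring (stalk X x)" by (rule stalk_local)
  show "germ X x U (global_section a) \<in> carrier (stalk X x)"
    using ring_hom_closed[OF germ_ring_hom[OF U_open x] global_section_closed[OF aR]] .
  fix \<beta> assume "\<beta> \<in> carrier (stalk X x)"
  then obtain W t where W: "is_open X W" "x \<in> W" and t: "t \<in> carrier (sect X W)"
    and \<beta>: "\<beta> = germ X x W t" by (rule stalk_carrierE)
  show "germ X x U (global_section a) \<otimes>\<^bsub>stalk X x\<^esub> \<beta> \<noteq> \<one>\<^bsub>stalk X x\<^esub>"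
  proof
    assume eq: "germ X x U (global_section a) \<otimes>\<^bsub>stalk X x\<^esub> \<beta> = \<one>\<^bsub>stalk X x\<^esub>"
    have o: "is_open X (U \<inter> W)" using U_open W by blast
    interpret S: cring "sect X (U \<inter> W)" using o by (rule sect_cring)
    let ?a = "res X U (U \<inter> W) (global_section a)" and ?t = "res X W (U \<inter> W) t"
    have c: "?a \<in> carrier (sect X (U \<inter> W))" "?t \<in> carrier (sect X (U \<inter> W))"
      using U_open W o t global_section_closed[OF aR] by (auto intro!: res_closed)
    have "germ X x (U \<inter> W) (?a \<otimes>\<^bsub>sect X (U \<inter> W)\<^esub> ?t) = germ X x (U \<inter> W) \<one>\<^bsub>sect X (U \<inter> W)\<^esub>"
      using eq \<beta> stalk_mult_germ[OF U_open x global_section_closed[OF aR] W t]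
        ring_hom_one[OF germ_ring_hom[OF o]] x W by simp
    \<comment> \<open>Equal germs give equal sections only after shrinking to some
      \<open>W'\<close>, which is again the preimage of an open set of the spectrum.\<close>
    then obtain W' where W': "is_open X W'" "x \<in> W'" "W' \<subseteq> U \<inter> W"
      and eq': "res X (U \<inter> W) W' (?a \<otimes>\<^bsub>sect X (U \<inter> W)\<^esub> ?t) = res X (U \<inter> W) W' \<one>\<^bsub>sect X (U \<inter> W)\<^esub>"
      using germ_eqD[of x "U \<inter> W" _ "U \<inter> W"] o x W S.one_closed by (metis IntI Int_absorb)
    obtain V where V: "openin (zariski R) V" "W' = chart_preim V"
      using open_eq_chart_preim[of W'] W' by blast
    have hom: "res X (U \<inter> W) W' \<in> ring_hom (sect X (U \<inter> W)) (sect X W')"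
      using o W' by (intro res_hom)
    have "res X (U \<inter> W) W' ?t \<in> carrier (sect X W')" using ring_hom_closed[OF hom c(2)] .
    then obtain \<tau> where \<tau>: "\<tau> \<in> carrier (sect (Spec R) V)" "res X (U \<inter> W) W' ?t = comorph \<phi> V \<tau>"
      using chart_surj[OF V(1)] V(2) by blast
    have "res X (U \<inter> W) W' ?a = res X U W' (global_section a)"
      using res_res[OF U_open o W'(1,3) _ global_section_closed[OF aR]] by simp
    also have "\<dots> = comorph \<phi> V (frac_section R V a \<one>\<^bsub>R\<^esub>)"
      using res_global_section[OF aR V(1)] V(2) by simp
    finally have ra: "res X (U \<inter> W) W' ?a = comorph \<phi> V (frac_section R V a \<one>\<^bsub>R\<^esub>)" .
    have fc: "frac_section R V a \<one>\<^bsub>R\<^esub> \<in> carrier (sect (Spec R) V)"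
      using V aR one_not_mem_point[OF V(1)] by (intro frac_section_closed) auto
    interpret Sp: cring "sect (Spec R) V"
    proof (rule ringed_space.sect_cring)
      show "ringed_space (Spec R)"
        using chart_morphism by (simp add: lrs_morphism_def locally_ringed_space_def)
    qed (simp add: is_open_Spec V)
    \<comment> \<open>Both factors are images under \<open>comorph \<phi> V\<close>, so injectivity
      moves the equation to the spectrum.\<close>
    have "comorph \<phi> V (frac_section R V a \<one>\<^bsub>R\<^esub> \<otimes>\<^bsub>sect (Spec R) V\<^esub> \<tau>)
        = res X (U \<inter> W) W' ?a \<otimes>\<^bsub>sect X W'\<^esub> res X (U \<inter> W) W' ?t"
      using ring_hom_mult[OF chart_hom[OF V(1)] fc \<tau>(1)] ra \<tau>(2) V(2) by simp
    also have "\<dots> = \<one>\<^bsub>sect X W'\<^esub>"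
      using eq' ring_hom_mult[OF hom c] ring_hom_one[OF hom] by simp
    also have "\<dots> = comorph \<phi> V \<one>\<^bsub>sect (Spec R) V\<^esub>"
      using ring_hom_one[OF chart_hom[OF V(1)]] V(2) by simp
    finally have "frac_section R V a \<one>\<^bsub>R\<^esub> \<otimes>\<^bsub>sect (Spec R) V\<^esub> \<tau> = \<one>\<^bsub>sect (Spec R) V\<^esub>"
      using bij_betw_imp_inj_on[OF chart_bij[OF V(1)]] fc \<tau>(1)
      by (auto dest!: inj_onD)
    moreover have q: "base \<phi> x \<in> V" using W' V by (simp add: mem_chart_preim)
    \<comment> \<open>Sections over the spectrum are functions with pointwise operations; this is
      the value of the equation at \<open>base \<phi> x\<close>.\<close>
    ultimately have "frac R (base \<phi> x) a \<one>\<^bsub>R\<^esub> \<otimes>\<^bsub>localization R (base \<phi> x)\<^esub> \<tau> (base \<phi> x)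
        = \<one>\<^bsub>localization R (base \<phi> x)\<^esub>"
      by (auto simp: Spec_def fun_ring_def frac_section_def dest!: fun_cong[of _ _ "base \<phi> x"])
    moreover have "\<tau> (base \<phi> x) \<in> carrier (localization R (base \<phi> x))"
      using \<tau>(1) q by (auto simp: Spec_def fun_ring_def spec_sections_def)
    ultimately have "a \<notin> base \<phi> x" using p.frac_unit_imp_not_mem[OF aR] by blast
    then show False using a by blast
  qed
qed

text \<open>Sections of the spectrum are locally fractions by definition. What is added is that the
  neighbourhood can be a basic open set \<open>D(g)\<close>: then a single element \<open>g\<close>
  vanishes at every point of the chart outside it.\<close>

lemma section_locally_fraction:
  assumes y: "y \<in> U" and W: "is_open X W" "y \<in> W" and f: "f \<in> carrier (sect X W)"
  obtains g a s V where "g \<in> carrier R" "a \<in> carrier R" "s \<in> carrier R"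
    "V = {p. primeideal p R \<and> g \<notin> p}" "openin (zariski R) V" "base \<phi> y \<in> V" "chart_preim V \<subseteq> W"
    "\<And>q. q \<in> V \<Longrightarrow> s \<notin> q" "res X W (chart_preim V) f = comorph \<phi> V (frac_section R V a s)"
proof -
  have o: "is_open X (U \<inter> W)" using U_open W by blast
  obtain V0 where V0: "openin (zariski R) V0" "U \<inter> W = chart_preim V0"
    using open_eq_chart_preim[OF o] by blast
  have "res X W (U \<inter> W) f \<in> carrier (sect X (chart_preim V0))"
    using W o f unfolding V0(2)[symmetric] by (intro res_closed) auto
  then obtain \<tau> where \<tau>: "\<tau> \<in> carrier (sect (Spec R) V0)" "res X W (U \<inter> W) f = comorph \<phi> V0 \<tau>"
    using chart_surj[OF V0(1)] by blast
  have y0: "base \<phi> y \<in> V0" using y W V0 mem_chart_preim by blast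
  have "\<tau> \<in> spec_sections R V0" using \<tau> by (simp add: Spec_def fun_ring_def)
  then have "\<exists>V a f. openin (zariski R) V \<and> base \<phi> y \<in> V \<and> V \<subseteq> V0 \<and> a \<in> carrier R \<and> f \<in> carrier R \<and>
       (\<forall>q \<in> V. f \<notin> q \<and> \<tau> q = frac R q a f)"
    using y0 unfolding spec_sections_def by blast
  then obtain V1 a s where V1: "openin (zariski R) V1" "base \<phi> y \<in> V1" "V1 \<subseteq> V0"
    and a: "a \<in> carrier R" "s \<in> carrier R" and fr: "\<And>q. q \<in> V1 \<Longrightarrow> s \<notin> q \<and> \<tau> q = frac R q a s"
    by blast
  obtain E where E: "E \<subseteq> carrier R" "V1 = {p. primeideal p R \<and> \<not> E \<subseteq> p}"
    using V1(1) unfolding openin_zariski zariski_open_def by blast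
  \<comment> \<open>The prime of \<open>y\<close> does not contain all of \<open>E\<close>; any
    element of \<open>E\<close> that it omits defines a basic open set between \<open>y\<close> and
    \<open>V1\<close>.\<close>
  obtain g where g: "g \<in> E" "g \<notin> base \<phi> y" using V1(2) E by blast
  define V where "V = {p. primeideal p R \<and> g \<notin> p}"
  have V: "openin (zariski R) V"
    unfolding openin_zariski zariski_open_def V_def
    by (rule exI[of _ "{g}"]) (use g E in auto)
  have V_V1: "V \<subseteq> V1" using g E by (auto simp: V_def)
  have yV: "base \<phi> y \<in> V" using g chart_base[OF y] by (simp add: V_def)
  have sub: "chart_preim V \<subseteq> U \<inter> W"
    unfolding V0(2) by (rule chart_preim_mono) (use V_V1 V1 in blast)
  have "res X W (chart_preim V) f = res X (U \<inter> W) (chart_preim V) (res X W (U \<inter> W) f)"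
    using res_res[OF W(1) o chart_preim_open[OF V] sub _ f] by simp
  also have "\<dots> = comorph \<phi> V (restrict \<tau> V)"
    using chart_res[OF V0(1) V _ \<tau>(1)] V_V1 V1(3) unfolding V0(2)[symmetric] \<tau>(2)[symmetric] by blast
  also have "restrict \<tau> V = frac_section R V a s"
    using fr V_V1 by (auto simp: frac_section_def restrict_def fun_eq_iff)
  finally have "res X W (chart_preim V) f = comorph \<phi> V (frac_section R V a s)" .
  moreover have "g \<in> carrier R" "chart_preim V \<subseteq> W" "\<And>q. q \<in> V \<Longrightarrow> s \<notin> q"
    using g(1) E(1) sub fr V_V1 by auto
  ultimately show thesis by (intro that[OF _ a V_def V yV])
qed

end

section \<open>The ideal sheaf of sections vanishing on a set\<close>

text \<open>Two germs are represented over a common neighbourhood, where the ideal axioms for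
  sections apply.\<close>

lemma (in ideal_sheaf) ideal_stalk_ideal:
  assumes x: "x \<in> points X" and S: "ring (stalk X x)"
  shows "ideal (stalk_ideal X I x) (stalk X x)"
proof (rule idealI)
  interpret S: ring "stalk X x" by (rule S)
  have mem: "germ X x U f \<in> stalk_ideal X I x" if "is_open X U" "x \<in> U" "f \<in> I U" for U f
    using that unfolding stalk_ideal_def by blast
  have carr: "f \<in> carrier (sect X U)" if "is_open X U" "f \<in> I U" for U f
    using that ideal.Icarr[OF ideal_sect] by blast
  have mult: "\<beta> \<otimes>\<^bsub>stalk X x\<^esub> \<alpha> \<in> stalk_ideal X I x" "\<alpha> \<otimes>\<^bsub>stalk X x\<^esub> \<beta> \<in> stalk_ideal X I x"
    if \<alpha>: "\<alpha> \<in> stalk_ideal X I x" and \<beta>: "\<beta> \<in> carrier (stalk X x)" for \<alpha> \<beta>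
  proof -
    obtain U f where U: "is_open X U" "x \<in> U" "f \<in> I U" "\<alpha> = germ X x U f"
      using \<alpha> unfolding stalk_ideal_def by blast
    obtain V g where V: "is_open X V" "x \<in> V" "g \<in> carrier (sect X V)" "\<beta> = germ X x V g"
      using \<beta> by (rule stalk_carrierE)
    have o: "is_open X (U \<inter> V)" "is_open X (V \<inter> U)" "x \<in> U \<inter> V" "x \<in> V \<inter> U" using U V by auto
    have f: "res X U (U \<inter> V) f \<in> I (U \<inter> V)" "res X U (V \<inter> U) f \<in> I (V \<inter> U)"
      using ideal_res[OF U(1) o(1) _ U(3)] ideal_res[OF U(1) o(2) _ U(3)] by auto
    have g: "res X V (U \<inter> V) g \<in> carrier (sect X (U \<inter> V))" "res X V (V \<inter> U) g \<in> carrier (sect X (V \<inter> U))"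
      using res_closed[OF V(1) o(1) _ V(3)] res_closed[OF V(1) o(2) _ V(3)] by auto
    show "\<beta> \<otimes>\<^bsub>stalk X x\<^esub> \<alpha> \<in> stalk_ideal X I x"
      unfolding U(4) V(4) stalk_mult_germ[OF V(1,2,3) U(1,2) carr[OF U(1,3)]]
      by (intro mem o ideal.I_l_closed[OF ideal_sect] f g)
    show "\<alpha> \<otimes>\<^bsub>stalk X x\<^esub> \<beta> \<in> stalk_ideal X I x"
      unfolding U(4) V(4) stalk_mult_germ[OF U(1,2) carr[OF U(1,3)] V(1,2,3)]
      by (intro mem o ideal.I_r_closed[OF ideal_sect] f g)
  qed
  show "ring (stalk X x)" by (rule S)
  show "\<beta> \<otimes>\<^bsub>stalk X x\<^esub> \<alpha> \<in> stalk_ideal X I x" "\<alpha> \<otimes>\<^bsub>stalk X x\<^esub> \<beta> \<in> stalk_ideal X I x"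
    if "\<alpha> \<in> stalk_ideal X I x" "\<beta> \<in> carrier (stalk X x)" for \<alpha> \<beta>
    using mult that by blast+
  show "subgroup (stalk_ideal X I x) (add_monoid (stalk X x))"
  proof (rule S.add.subgroupI)
    show sub: "stalk_ideal X I x \<subseteq> carrier (stalk X x)"
      using carr by (auto simp: stalk_ideal_def stalk_def)
    have "\<zero>\<^bsub>sect X (points X)\<^esub> \<in> I (points X)"
      using additive_subgroup.zero_closed[OF ideal.axioms(1)[OF ideal_sect]] by blast
    then show "stalk_ideal X I x \<noteq> {}" using mem[OF openin_topspace x] by blast
    fix \<alpha> assume \<alpha>: "\<alpha> \<in> stalk_ideal X I x"
    \<comment> \<open>Negation is multiplication by minus one, so closure under multiples already
      covers it.\<close>
    have "\<ominus>\<^bsub>stalk X x\<^esub> \<alpha> = (\<ominus>\<^bsub>stalk X x\<^esub> \<one>\<^bsub>stalk X x\<^esub>) \<otimes>\<^bsub>stalk X x\<^esub> \<alpha>"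
      using \<alpha> sub by (auto simp: S.l_minus)
    then show "\<ominus>\<^bsub>stalk X x\<^esub> \<alpha> \<in> stalk_ideal X I x" using mult(1)[OF \<alpha>] by simp
    fix \<beta> assume \<beta>: "\<beta> \<in> stalk_ideal X I x"
    obtain U f where U: "is_open X U" "x \<in> U" "f \<in> I U" "\<alpha> = germ X x U f"
      using \<alpha> unfolding stalk_ideal_def by blast
    obtain V g where V: "is_open X V" "x \<in> V" "g \<in> I V" "\<beta> = germ X x V g"
      using \<beta> unfolding stalk_ideal_def by blast
    have o: "is_open X (U \<inter> V)" "x \<in> U \<inter> V" using U V by auto
    have "res X U (U \<inter> V) f \<in> I (U \<inter> V)" "res X V (U \<inter> V) g \<in> I (U \<inter> V)"
      using ideal_res[OF U(1) o(1) _ U(3)] ideal_res[OF V(1) o(1) _ V(3)] by auto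
    then show "\<alpha> \<oplus>\<^bsub>stalk X x\<^esub> \<beta> \<in> stalk_ideal X I x"
      unfolding U(4) V(4) stalk_add_germ[OF U(1,2) carr[OF U(1,3)] V(1,2) carr[OF V(1,3)]]
      by (intro mem o additive_subgroup.a_closed[OF ideal.axioms(1)[OF ideal_sect]])
  qed
qed

text \<open>A germ in the maximal ideal is one whose value in the residue field is zero, so these
  are the functions vanishing on \<open>C\<close>.\<close>

definition vanishing_ideal :: "('p, 'a) rspace \<Rightarrow> 'p set \<Rightarrow> 'p set \<Rightarrow> 'a set" where
  "vanishing_ideal X C U =
    {f \<in> carrier (sect X U). \<forall>x \<in> U \<inter> C. germ X x U f \<in> max_ideal (stalk X x)}"

section \<open>Sheaf axioms and zero locus of the vanishing ideal\<close>

context locally_ringed_space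
begin

lemma maximalideal_stalk: "x \<in> points X \<Longrightarrow> maximalideal (max_ideal (stalk X x)) (stalk X x)"
  by (intro maximalideal_max_ideal stalk_local)

lemma ideal_vanishing_ideal:
  assumes U: "is_open X U"
  shows "ideal (vanishing_ideal X C U) (sect X U)"
proof -
  interpret S: cring "sect X U" using U by (rule sect_cring)
  let ?J = "\<lambda>x. {f \<in> carrier (sect X U). germ X x U f \<in> max_ideal (stalk X x)}"
  have J: "ideal (?J x) (sect X U)" if x: "x \<in> U" for x
  proof -
    have xX: "x \<in> points X" using x U openin_subset by blast
    interpret M: maximalideal "max_ideal (stalk X x)" "stalk X x" using xX by (rule maximalideal_stalk)
    interpret h: ring_hom_ring "sect X U" "stalk X x" "germ X x U"
      using germ_ring_hom[OF U x] S.ring_axioms M.ring_axioms by (intro ring_hom_ringI2)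
    show ?thesis using h.ideal_vimage[OF M.ideal_axioms] by simp
  qed
  \<comment> \<open>An intersection of preimages of maximal ideals under the germ maps. The carrier
    is inserted to keep the family nonempty when \<open>U\<close> misses \<open>C\<close>.\<close>
  have "vanishing_ideal X C U = (\<Inter>(insert (carrier (sect X U)) (?J ` (U \<inter> C))))"
    by (auto simp: vanishing_ideal_def)
  moreover have "ideal \<dots> (sect X U)"
    by (rule S.i_Intersect) (use J S.oneideal in auto)
  ultimately show ?thesis by simp
qed

text \<open>Vanishing is tested on germs, and germs do not change under restriction; so it both
  restricts and can be checked on a cover.\<close>

lemma ideal_sheaf_vanishing_ideal: "ideal_sheaf X (vanishing_ideal X C)"
proof (intro ideal_sheaf.intro ideal_sheaf_axioms.intro ringed_space_axioms)
  show "ideal (vanishing_ideal X C U) (sect X U)" if "is_open X U" for U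
    using that by (rule ideal_vanishing_ideal)
  show "res X U V f \<in> vanishing_ideal X C V"
    if "is_open X U" "is_open X V" "V \<subseteq> U" "f \<in> vanishing_ideal X C U" for U V f
    using that by (auto simp: vanishing_ideal_def res_closed germ_res)
  show "f \<in> vanishing_ideal X C (\<Union>\<U>)"
    if op: "\<And>V. V \<in> \<U> \<Longrightarrow> is_open X V" and f: "f \<in> carrier (sect X (\<Union>\<U>))"
      and loc: "\<And>V. V \<in> \<U> \<Longrightarrow> res X (\<Union>\<U>) V f \<in> vanishing_ideal X C V" for \<U> f
  proof -
    have "germ X x (\<Union>\<U>) f \<in> max_ideal (stalk X x)" if x: "x \<in> \<Union>\<U> \<inter> C" for x
    proof -
      obtain V where V: "V \<in> \<U>" "x \<in> V" using x by blast
      have "germ X x V (res X (\<Union>\<U>) V f) \<in> max_ideal (stalk X x)"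
        using loc[OF V(1)] V x by (auto simp: vanishing_ideal_def)
      moreover have "is_open X (\<Union>\<U>)" using op by (rule openin_Union)
      ultimately show ?thesis using germ_res[of "\<Union>\<U>" V x f] op V f Union_upper[OF V(1)] by simp
    qed
    then show ?thesis using f by (auto simp: vanishing_ideal_def)
  qed
qed

text \<open>On \<open>C\<close> the stalk ideal lies inside the maximal ideal. Off \<open>C\<close>,
  closedness leaves a neighbourhood that misses \<open>C\<close>, where the vanishing condition is
  vacuous and every germ belongs to the stalk ideal.\<close>

lemma zero_locus_vanishing_ideal:
  assumes C: "closedin (topo X) C"
  shows "zero_locus X (vanishing_ideal X C) = C"
proof -
  have CX: "C \<subseteq> points X" using C by (rule closedin_subset)
  have "stalk_ideal X (vanishing_ideal X C) x \<noteq> carrier (stalk X x)" if x: "x \<in> C" for x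
  proof -
    interpret M: maximalideal "max_ideal (stalk X x)" "stalk X x"
      using x CX by (intro maximalideal_stalk) auto
    have "stalk_ideal X (vanishing_ideal X C) x \<subseteq> max_ideal (stalk X x)"
      using x by (auto simp: stalk_ideal_def vanishing_ideal_def)
    then show ?thesis using M.I_notcarr M.a_subset by blast
  qed
  moreover have "stalk_ideal X (vanishing_ideal X C) x = carrier (stalk X x)"
    if x: "x \<in> points X" "x \<notin> C" for x
  proof
    show "stalk_ideal X (vanishing_ideal X C) x \<subseteq> carrier (stalk X x)"
      by (auto simp: stalk_ideal_def vanishing_ideal_def stalk_def)
    show "carrier (stalk X x) \<subseteq> stalk_ideal X (vanishing_ideal X C) x"
    proof
      fix \<alpha> assume "\<alpha> \<in> carrier (stalk X x)"
      then obtain U f where U: "is_open X U" "x \<in> U" "f \<in> carrier (sect X U)" "\<alpha> = germ X x U f"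
        by (rule stalk_carrierE)
      let ?V = "U \<inter> (points X - C)"
      have V: "is_open X ?V" "x \<in> ?V" using U x C by (auto intro: openin_Int openin_diff)
      have "res X U ?V f \<in> vanishing_ideal X C ?V"
        using res_closed[OF U(1) V(1) _ U(3)] by (auto simp: vanishing_ideal_def)
      moreover have "\<alpha> = germ X x ?V (res X U ?V f)"
        using germ_res[OF U(1) V(1) _ V(2) U(3)] U(4) by simp
      ultimately show "\<alpha> \<in> stalk_ideal X (vanishing_ideal X C) x"
        using V unfolding stalk_ideal_def by blast
    qed
  qed
  ultimately show ?thesis using CX by (auto simp: zero_locus_def)
qed

end

text \<open>On \<open>D(g)\<close>, where \<open>f = a/s\<close>, the section \<open>a g\<close> equals \<open>f\<close> times \<open>s g\<close>, so it vanishes where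
  \<open>f\<close> does; off \<open>D(g)\<close> it vanishes because \<open>g\<close> does. So \<open>a g\<close> lies in the ideal over the whole
  chart, and it differs from \<open>f\<close> by the unit \<open>s g\<close> on \<open>D(g)\<close>.\<close>

lemma (in affine_chart) stalk_ideal_vanishing_ideal:
  assumes y: "y \<in> U"
  shows "stalk_ideal X (vanishing_ideal X C) y
    = genideal (stalk X y) (germ X y U ` vanishing_ideal X C U)" (is "?I = ?G")
proof
  have yX: "y \<in> points X" using y U_open openin_subset by blast
  interpret S: cring "stalk X y" using stalk_local[OF yX] by (simp add: local_ring_def)
  have sub: "germ X y U ` vanishing_ideal X C U \<subseteq> ?I"
    using y U_open by (auto simp: stalk_ideal_def)
  have I: "ideal ?I (stalk X y)"
    using ideal_sheaf.ideal_stalk_ideal[OF ideal_sheaf_vanishing_ideal yX S.ring_axioms] .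
  show "?G \<subseteq> ?I" using I sub by (rule S.genideal_minimal)
  have gens: "germ X y U ` vanishing_ideal X C U \<subseteq> carrier (stalk X y)"
    using sub ideal.Icarr[OF I] by blast
  show "?I \<subseteq> ?G"
  proof
    fix \<alpha> assume "\<alpha> \<in> ?I"
    then obtain W f where W: "is_open X W" "y \<in> W" and fI: "f \<in> vanishing_ideal X C W"
      and \<alpha>: "\<alpha> = germ X y W f" unfolding stalk_ideal_def by blast
    have f: "f \<in> carrier (sect X W)" using fI by (simp add: vanishing_ideal_def)
    obtain g a s V where R: "g \<in> carrier R" "a \<in> carrier R" "s \<in> carrier R"
      and V_eq: "V = {p. primeideal p R \<and> g \<notin> p}" and V: "openin (zariski R) V"
      and yV: "base \<phi> y \<in> V" and VW: "chart_preim V \<subseteq> W" and s: "\<And>q. q \<in> V \<Longrightarrow> s \<notin> q"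
      and resf: "res X W (chart_preim V) f = comorph \<phi> V (frac_section R V a s)"
      by (rule section_locally_fraction[OF y W f]) blast
    \<comment> \<open>At primes in \<open>V\<close> neither \<open>s\<close> nor \<open>g\<close>
      belongs to the prime, so \<open>s g\<close> may serve as a denominator over
      \<open>V\<close>.\<close>
    have sg: "s \<otimes>\<^bsub>R\<^esub> g \<notin> q" if q: "q \<in> V" for q
      using primeideal.mult_not_mem[of q R s g] q s[OF q] R by (auto simp: V_eq)
    note one = one_not_mem_point[OF V]
    let ?B = "chart_preim V" and ?fs = "frac_section R V"
    have B: "is_open X ?B" using V by (rule chart_preim_open)
    have BU: "?B \<subseteq> U" by (auto simp: mem_chart_preim)
    have fs: "?fs a s \<in> carrier (sect (Spec R) V)"
      "?fs (s \<otimes>\<^bsub>R\<^esub> g) \<one>\<^bsub>R\<^esub> \<in> carrier (sect (Spec R) V)"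
      "?fs (a \<otimes>\<^bsub>R\<^esub> g) \<one>\<^bsub>R\<^esub> \<in> carrier (sect (Spec R) V)"
      "?fs \<one>\<^bsub>R\<^esub> (s \<otimes>\<^bsub>R\<^esub> g) \<in> carrier (sect (Spec R) V)"
      using V R s sg one by (auto intro!: frac_section_closed)
    note cs = fs[THEN ring_hom_closed[OF chart_hom[OF V]]]
    \<comment> \<open>\<open>m1\<close> exhibits \<open>a g\<close> as a multiple of
      \<open>f\<close> and yields the vanishing of \<open>?F\<close> on the part of \<open>C\<close>
      inside \<open>?B\<close>; \<open>m2\<close> is the converse relation and yields
      generation.\<close>
    have "?fs a s \<otimes>\<^bsub>sect (Spec R) V\<^esub> ?fs (s \<otimes>\<^bsub>R\<^esub> g) \<one>\<^bsub>R\<^esub>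
        = ?fs (a \<otimes>\<^bsub>R\<^esub> (s \<otimes>\<^bsub>R\<^esub> g)) (s \<otimes>\<^bsub>R\<^esub> \<one>\<^bsub>R\<^esub>)"
      using R s one by (intro frac_section_mult V) auto
    also have "\<dots> = ?fs (a \<otimes>\<^bsub>R\<^esub> g) \<one>\<^bsub>R\<^esub>"
      using R s one by (intro frac_section_eqI V) (auto simp: R.m_ac)
    finally have m1: "?fs a s \<otimes>\<^bsub>sect (Spec R) V\<^esub> ?fs (s \<otimes>\<^bsub>R\<^esub> g) \<one>\<^bsub>R\<^esub> = ?fs (a \<otimes>\<^bsub>R\<^esub> g) \<one>\<^bsub>R\<^esub>" .
    have "?fs (a \<otimes>\<^bsub>R\<^esub> g) \<one>\<^bsub>R\<^esub> \<otimes>\<^bsub>sect (Spec R) V\<^esub> ?fs \<one>\<^bsub>R\<^esub> (s \<otimes>\<^bsub>R\<^esub> g)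
        = ?fs ((a \<otimes>\<^bsub>R\<^esub> g) \<otimes>\<^bsub>R\<^esub> \<one>\<^bsub>R\<^esub>) (\<one>\<^bsub>R\<^esub> \<otimes>\<^bsub>R\<^esub> (s \<otimes>\<^bsub>R\<^esub> g))"
      using R sg one by (intro frac_section_mult V) auto
    also have "\<dots> = ?fs a s"
      using R s sg by (intro frac_section_eqI V) (auto simp: R.m_ac)
    finally have m2: "?fs (a \<otimes>\<^bsub>R\<^esub> g) \<one>\<^bsub>R\<^esub> \<otimes>\<^bsub>sect (Spec R) V\<^esub> ?fs \<one>\<^bsub>R\<^esub> (s \<otimes>\<^bsub>R\<^esub> g) = ?fs a s" .
    let ?F = "global_section (a \<otimes>\<^bsub>R\<^esub> g)"
    have ag: "a \<otimes>\<^bsub>R\<^esub> g \<in> carrier R" using R by simp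
    have Fc: "?F \<in> carrier (sect X U)" using ag by (rule global_section_closed)
    have germF: "germ X x U ?F = germ X x ?B (comorph \<phi> V (?fs (a \<otimes>\<^bsub>R\<^esub> g) \<one>\<^bsub>R\<^esub>))" if "x \<in> ?B" for x
      using germ_res[OF U_open B BU that Fc] res_global_section[OF ag V] by simp
    have germf: "germ X x W f = germ X x ?B (comorph \<phi> V (?fs a s))" if "x \<in> ?B" for x
      using germ_res[OF W(1) B VW that f] resf by simp
    have "germ X x U ?F \<in> max_ideal (stalk X x)" if x: "x \<in> U \<inter> C" for x
    proof (cases "g \<in> base \<phi> x")
      case True
      interpret p: primeideal "base \<phi> x" R using x chart_base by blast
      show ?thesis using x True R p.I_l_closed by (intro germ_global_section_in_max_ideal) auto
    next
      case False
      then have xB: "x \<in> ?B" using x chart_base by (auto simp: mem_chart_preim V_eq)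
      have xX: "x \<in> points X" using x U_open openin_subset by blast
      interpret M: maximalideal "max_ideal (stalk X x)" "stalk X x" using xX by (rule maximalideal_stalk)
      have "germ X x U ?F = germ X x W f \<otimes>\<^bsub>stalk X x\<^esub> germ X x ?B (comorph \<phi> V (?fs (s \<otimes>\<^bsub>R\<^esub> g) \<one>\<^bsub>R\<^esub>))"
        unfolding germF[OF xB] germf[OF xB] m1[symmetric] ring_hom_mult[OF chart_hom[OF V] fs(1,2)]
        using ring_hom_mult[OF germ_ring_hom[OF B xB] cs(1,2)] .
      moreover have "germ X x W f \<in> max_ideal (stalk X x)"
        using fI x xB VW by (auto simp: vanishing_ideal_def)
      ultimately show ?thesis
        using M.I_r_closed ring_hom_closed[OF germ_ring_hom[OF B xB] cs(2)] by simp
    qed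
    then have "?F \<in> vanishing_ideal X C U" using Fc by (simp add: vanishing_ideal_def)
    then have FG: "germ X y U ?F \<in> ?G" using S.genideal_self[OF gens] by blast
    have yB: "y \<in> ?B" using y yV by (simp add: mem_chart_preim)
    \<comment> \<open>Near \<open>y\<close> the given germ is the global generator divided by
      \<open>s g\<close>.\<close>
    have "\<alpha> = germ X y U ?F \<otimes>\<^bsub>stalk X y\<^esub> germ X y ?B (comorph \<phi> V (?fs \<one>\<^bsub>R\<^esub> (s \<otimes>\<^bsub>R\<^esub> g)))"
      unfolding \<alpha> germF[OF yB] germf[OF yB] m2[symmetric] ring_hom_mult[OF chart_hom[OF V] fs(3,4)]
      using ring_hom_mult[OF germ_ring_hom[OF B yB] cs(3,4)] .
    then show "\<alpha> \<in> ?G"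
      using ideal.I_r_closed[OF S.genideal_ideal[OF gens] FG]
        ring_hom_closed[OF germ_ring_hom[OF B yB] cs(4)] by simp
  qed
qed

section \<open>Closed sets of a scheme as closed subschemes\<close>

context scheme
begin

text \<open>One affine neighbourhood of \<open>x\<close> serves all its points \<open>y\<close> at
  once, since the sections over the whole chart generate each stalk ideal.\<close>

lemma locally_generated_vanishing_ideal: "locally_generated X (vanishing_ideal X C)"
  unfolding locally_generated_def
proof
  fix x assume "x \<in> points X"
  then obtain U where U: "is_open X U" "x \<in> U" "affine_scheme (open_subspace X U)"
    using locally_affine by blast
  then obtain R :: "'b ring" and \<phi> where "cring R" "lrs_isomorphism (open_subspace X U) (Spec R) \<phi>"
    unfolding affine_scheme_def by blast
  then interpret affine_chart X U R \<phi>
    using U locally_ringed_space_axioms by (intro affine_chart.intro affine_chart_axioms.intro)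
  show "\<exists>U. is_open X U \<and> x \<in> U \<and> (\<forall>y \<in> U. stalk_ideal X (vanishing_ideal X C) y
      = genideal (stalk X y) (germ X y U ` vanishing_ideal X C U))"
    using U stalk_ideal_vanishing_ideal by blast
qed

lemma closed_subscheme_of_closedin:
  assumes "closedin (topo X) C"
  shows "closed_subscheme X (closed_subspace X (vanishing_ideal X C))"
    and "points (closed_subspace X (vanishing_ideal X C)) = C"
proof -
  show "closed_subscheme X (closed_subspace X (vanishing_ideal X C))"
    unfolding closed_subscheme_def
    using ideal_sheaf_vanishing_ideal locally_generated_vanishing_ideal by blast
  show "points (closed_subspace X (vanishing_ideal X C)) = C"
    using closedin_subset[OF assms] zero_locus_vanishing_ideal[OF assms]
    by (auto simp: closed_subspace_def)
qed

end

section \<open>Descent to a countable scheme\<close>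

theorem theorem1p1:
  fixes S :: "('p, 'a) rspace"
    and P :: "'p \<Rightarrow> bool"
    and S' :: "('q, 'b) rspace"
    and \<pi> :: "('p, 'a, 'q, 'b) rmorph"
    and P' :: "'q \<Rightarrow> bool"
  assumes "scheme S"
    and "countable_scheme S'"
    and "lrs_morphism S S' \<pi>"
    and "descends_along S \<pi> P P'"
    and "specialization_condition S' P'"
  shows "\<exists>Z :: nat \<Rightarrow> ('p, 'p \<Rightarrow> ('p set \<times> 'a) set set) rspace.
    (\<forall>j \<ge> 1. closed_subscheme S (Z j)) \<and>
    (\<forall>s \<in> points S. P s \<longleftrightarrow> (\<exists>j \<ge> 1. s \<in> points (Z j)))"
proof -
  interpret scheme S by (rule assms(1))
  define T where "T = {t \<in> points S'. P' t}"
  \<comment> \<open>The empty set is added so that \<open>\<C>\<close> can be enumerated even if \<open>T\<close> is empty.\<close>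
  define \<C> where "\<C> = insert {} ((\<lambda>t. {s \<in> points S. base \<pi> s \<in> topo S' closure_of {t}}) ` T)"
  have "countable T"
    using assms(2) by (auto simp: countable_scheme_def T_def intro: countable_subset)
  then have \<C>: "countable \<C>" "\<C> \<noteq> {}" by (auto simp: \<C>_def)
  have cont: "continuous_map (topo S) (topo S') (base \<pi>)"
    using assms(3) by (simp add: lrs_morphism_def)
  have closed: "closedin (topo S) C" if "C \<in> \<C>" for C
    using that closedin_continuous_map_preimage[OF cont closedin_closure_of] by (auto simp: \<C>_def)
  have P_iff: "P s \<longleftrightarrow> (\<exists>C \<in> \<C>. s \<in> C)" if s: "s \<in> points S" for s
  proof -
    have \<pi>s: "base \<pi> s \<in> points S'" using cont s continuous_map_image_subset_topspace by blast
    have "P s \<longleftrightarrow> P' (base \<pi> s)" using assms(4) s by (simp add: descends_along_def)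
    \<comment> \<open>For one direction \<open>t\<close> is the image of \<open>s\<close> itself,
      which lies in its own closure; the other is the specialization condition.\<close>
    also have "\<dots> \<longleftrightarrow> (\<exists>t \<in> T. base \<pi> s \<in> topo S' closure_of {t})"
    proof
      assume "P' (base \<pi> s)"
      moreover have "base \<pi> s \<in> topo S' closure_of {base \<pi> s}"
        using closure_of_subset[of "{base \<pi> s}" "topo S'"] \<pi>s by simp
      ultimately show "\<exists>t \<in> T. base \<pi> s \<in> topo S' closure_of {t}"
        using \<pi>s by (auto simp: T_def)
    next
      assume "\<exists>t \<in> T. base \<pi> s \<in> topo S' closure_of {t}"
      then show "P' (base \<pi> s)"
        using assms(5) unfolding specialization_condition_def T_def by blast
    qed
    finally show ?thesis using s by (auto simp: \<C>_def)
  qed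
  \<comment> \<open>\<open>from_nat_into\<close> enumerates from 0 and may repeat sets, so a finite
    family also fills all indices; the shift makes the subschemes start at index 1.\<close>
  define Z where "Z j = closed_subspace S (vanishing_ideal S (from_nat_into \<C> (j - 1)))" for j
  have Z: "closed_subscheme S (Z j)" "points (Z j) = from_nat_into \<C> (j - 1)" for j
    using closed_subscheme_of_closedin[OF closed[OF from_nat_into[OF \<C>(2)]]]
    by (auto simp: Z_def)
  have "(\<exists>j \<ge> 1. s \<in> points (Z j)) \<longleftrightarrow> (\<exists>C \<in> \<C>. s \<in> C)" for s
  proof
    assume "\<exists>j \<ge> 1. s \<in> points (Z j)"
    then show "\<exists>C \<in> \<C>. s \<in> C" using Z(2) from_nat_into[OF \<C>(2)] by auto
  next
    assume "\<exists>C \<in> \<C>. s \<in> C"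
    then obtain n where "s \<in> from_nat_into \<C> n"
      using from_nat_into_surj[OF \<C>(1)] by blast
    then have "s \<in> points (Z (Suc n))" by (simp add: Z(2))
    then show "\<exists>j \<ge> 1. s \<in> points (Z j)" by (intro exI[of _ "Suc n"]) auto
  qed
  then show ?thesis using Z(1) P_iff by (intro exI[of _ Z]) simp
qed

end
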